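(* Let $G$ be a Roelcke precompact subgroup of $S_\infty$. Then the following hold: (i) If $H \leq G$ is a commensurator, $V \unlhd H$ is open, and $\sigma$ is a representation of $H/V$, then $\mathrm{Ind}_H^G(\sigma)$ is irreducible if and only if $\sigma$ is irreducible. (ii) If $H_1, H_2 \leq G$ are commensurators, $V_1 \unlhd H_1$ and $V_2 \unlhd H_2$ are open, and $\sigma_1$, $\sigma_2$ are irreducible representations of $H_1/V_1$, $H_2/V_2$, respectively, then $\mathrm{Ind}_{H_1}^G(\sigma_1) \cong \mathrm{Ind}_{H_2}^G(\sigma_2)$ if and only if there exists $g \in G$ such that $H_2 = gH_1g^{-1}$ and $\sigma_2 \cong \sigma_1^g$.
   Context: $S_\infty$ is the group of all permutations of a countably infinite set, with the topology of pointwise convergence (the set being discrete); subgroups carry the subspace topology. A topological group $G$ is Roelcke precompact if for every neighborhood $U$ of the identity there is a finite $F \subseteq G$ with $G = UFU$. Two subgroups are commensurate if their intersection has finite index in both; $\mathrm{Comm}_G(H) = \{g \in G : H \text{ and } gHg^{-1}\text{ are commensurate}\}$. An open subgroup $H \le G$ is called a commensurator if $\mathrm{Comm}_G(H) = H$. Representations are strongly continuous unitary representations on complex Hilbert spaces; $\cong$ denotes unitary equivalence. A representation of a quotient $H/V$ is also regarded as a representation of $H$ via the quotient map. For $g \in G$ and a representation $\sigma$ of $H$, $\sigma^g$ is the representation of $gHg^{-1}$ given by $\sigma^g(x) = \sigma(g^{-1}xg)$. If $H$ is an open subgroup of $G$ and $\sigma$ a representation of $H$ on $\mathcal{H}(\sigma)$,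 the induced representation $\mathrm{Ind}_H^G(\sigma)$ acts on the Hilbert space of all $f\colon G \to \mathcal{H}(\sigma)$ satisfying $f(gh) = \sigma(h^{-1})f(g)$ for all $g \in G$, $h \in H$, and $\|f\|^2 = \sum_{g \in T}\|f(g)\|^2 < \infty$, where $T$ is a complete system of left coset representatives of $H$ in $G$; the action is $(\mathrm{Ind}_H^G(\sigma)(g)f)(x) = f(g^{-1}x)$. *)

theory Defs
  imports "HOL-Analysis.Analysis" "HOL-Algebra.Algebra" "HOL-Algebra.Left_Coset"
    "HOL-Algebra.Algebraic_Closure_Type"
begin

section \<open>Permutation groups, Roelcke precompactness, commensurators\<close>

text \<open>The elements of \<^term>\<open>Bij \<Omega>\<close> are extensional, so \<^term>\<open>Bij \<Omega>\<close> lies in the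
  topological space \<open>\<Omega> \<rightarrow>\<^sub>E \<Omega>\<close> underlying the product topology.\<close>

definition pointwise_topology :: "'a set \<Rightarrow> ('a \<Rightarrow> 'a) topology" where
  "pointwise_topology \<Omega> =
     subtopology (product_topology (\<lambda>_. discrete_topology \<Omega>) \<Omega>) (Bij \<Omega>)"

definition roelcke_precompact :: "('g, 'm) monoid_scheme \<Rightarrow> 'g topology \<Rightarrow> bool" where
  "roelcke_precompact G T \<longleftrightarrow>
     (\<forall>U. U \<subseteq> carrier G \<and> (\<exists>W. openin T W \<and> \<one>\<^bsub>G\<^esub> \<in> W \<and> W \<subseteq> U) \<longrightarrow>
        (\<exists>F. finite F \<and> F \<subseteq> carrier G \<and> carrier G = U <#>\<^bsub>G\<^esub> F <#>\<^bsub>G\<^esub> U))"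

text \<open>Finite index is stated as finiteness of the set of cosets, since \<^const>\<open>card\<close> of an
  infinite set is \<open>0\<close>.\<close>

definition commensurate :: "('g, 'm) monoid_scheme \<Rightarrow> 'g set \<Rightarrow> 'g set \<Rightarrow> bool" where
  "commensurate G H K \<longleftrightarrow>
     finite (lcosets\<^bsub>G\<lparr>carrier := H\<rparr>\<^esub> (H \<inter> K)) \<and>
     finite (lcosets\<^bsub>G\<lparr>carrier := K\<rparr>\<^esub> (H \<inter> K))"

definition Comm :: "('g, 'm) monoid_scheme \<Rightarrow> 'g set \<Rightarrow> 'g set" where
  "Comm G H = {g \<in> carrier G. commensurate G H (g <#\<^bsub>G\<^esub> H #>\<^bsub>G\<^esub> inv\<^bsub>G\<^esub> g)}"

definition commensurator :: "('g, 'm) monoid_scheme \<Rightarrow> 'g topology \<Rightarrow> 'g set \<Rightarrow> bool" where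
  "commensurator G T H \<longleftrightarrow> subgroup H G \<and> openin T H \<and> Comm G H = H"

text \<open>The topology of \<open>H / V\<close>, where \<open>T\<close> is the topology of the group \<open>H\<close>.\<close>

definition quotient_topology ::
    "('g, 'm) monoid_scheme \<Rightarrow> 'g topology \<Rightarrow> 'g set \<Rightarrow> 'g set topology" where
  "quotient_topology H T V =
     topology (\<lambda>\<U>. \<U> \<subseteq> carrier (H Mod V) \<and> openin T {h \<in> topspace T. V #>\<^bsub>H\<^esub> h \<in> \<U>})"

lemma openin_quotient_topology:
  "openin (quotient_topology H T V) \<U> \<longleftrightarrow>
     \<U> \<subseteq> carrier (H Mod V) \<and> openin T {h \<in> topspace T. V #>\<^bsub>H\<^esub> h \<in> \<U>}"
proof -
  let ?p = "\<lambda>\<U>. {h \<in> topspace T. V #>\<^bsub>H\<^esub> h \<in> \<U>}"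
  have "?p (A \<inter> B) = ?p A \<inter> ?p B" and "?p (\<Union>\<K>) = (\<Union>K\<in>\<K>. ?p K)" for A B \<K>
    by auto
  then have "istopology (\<lambda>\<U>. \<U> \<subseteq> carrier (H Mod V) \<and> openin T (?p \<U>))"
    unfolding istopology_def by (auto simp: openin_Int intro!: openin_Union)
  then show ?thesis
    unfolding quotient_topology_def by (simp add: topology_inverse')
qed

section \<open>Complex Hilbert spaces\<close>

text \<open>Hilbert spaces carry an explicit carrier set because induced representations live on a
  subset of a function type. The fields \<open>mult\<close> and \<open>one\<close> inherited from the record of
  modules play no role.\<close>

record 'h hilbert_space = "(complex, 'h) module" +
  hinner :: "'h \<Rightarrow> 'h \<Rightarrow> complex"

abbreviation complex_ring :: "complex ring" where
  "complex_ring \<equiv> ring_of_type_algebra"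

definition hnorm :: "('h, 'm) hilbert_space_scheme \<Rightarrow> 'h \<Rightarrow> real" where
  "hnorm E x = sqrt (Re (hinner E x x))"

text \<open>The value off the carrier is fixed because \<^locale>\<open>Metric_space\<close> requires
  nonnegativity and symmetry on the whole type.\<close>

definition hdist :: "('h, 'm) hilbert_space_scheme \<Rightarrow> 'h \<Rightarrow> 'h \<Rightarrow> real" where
  "hdist E x y = (if x \<in> carrier E \<and> y \<in> carrier E then hnorm E (x \<ominus>\<^bsub>E\<^esub> y) else 0)"

abbreviation hilbert_topology :: "('h, 'm) hilbert_space_scheme \<Rightarrow> 'h topology" where
  "hilbert_topology E \<equiv> Metric_space.mtopology (carrier E) (hdist E)"

locale complex_hilbert_space =
  Module.module complex_ring E for E :: "('h, 'm) hilbert_space_scheme" (structure) +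
  assumes hinner_add:
      "\<lbrakk>x \<in> carrier E; y \<in> carrier E; z \<in> carrier E\<rbrakk>
        \<Longrightarrow> hinner E (x \<oplus> y) z = hinner E x z + hinner E y z"
    and hinner_smult:
      "\<lbrakk>x \<in> carrier E; y \<in> carrier E\<rbrakk> \<Longrightarrow> hinner E (c \<odot> x) y = c * hinner E x y"
    and hinner_commute:
      "\<lbrakk>x \<in> carrier E; y \<in> carrier E\<rbrakk> \<Longrightarrow> hinner E y x = cnj (hinner E x y)"
    and hinner_nonneg: "x \<in> carrier E \<Longrightarrow> 0 \<le> Re (hinner E x x)"
    and hinner_definite: "\<lbrakk>x \<in> carrier E; hinner E x x = 0\<rbrakk> \<Longrightarrow> x = \<zero>"
    and complete: "Metric_space.mcomplete (carrier E) (hdist E)"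

definition unitary_map ::
    "('h, 'm) hilbert_space_scheme \<Rightarrow> ('k, 'n) hilbert_space_scheme \<Rightarrow> ('h \<Rightarrow> 'k) \<Rightarrow> bool" where
  "unitary_map E F U \<longleftrightarrow>
     bij_betw U (carrier E) (carrier F) \<and>
     (\<forall>x\<in>carrier E. \<forall>y\<in>carrier E. U (x \<oplus>\<^bsub>E\<^esub> y) = U x \<oplus>\<^bsub>F\<^esub> U y) \<and>
     (\<forall>c. \<forall>x\<in>carrier E. U (c \<odot>\<^bsub>E\<^esub> x) = c \<odot>\<^bsub>F\<^esub> U x) \<and>
     (\<forall>x\<in>carrier E. \<forall>y\<in>carrier E. hinner F (U x) (U y) = hinner E x y)"

section \<open>Unitary representations\<close>

record ('g, 'h) rep =
  rep_space :: "'h hilbert_space"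
  rep_act :: "'g \<Rightarrow> 'h \<Rightarrow> 'h"

definition unitary_rep :: "('g, 'm) monoid_scheme \<Rightarrow> 'g topology \<Rightarrow> ('g, 'h) rep \<Rightarrow> bool" where
  "unitary_rep G T \<pi> \<longleftrightarrow>
     complex_hilbert_space (rep_space \<pi>) \<and>
     (\<forall>g\<in>carrier G. unitary_map (rep_space \<pi>) (rep_space \<pi>) (rep_act \<pi> g)) \<and>
     (\<forall>g\<in>carrier G. \<forall>h\<in>carrier G. \<forall>v\<in>carrier (rep_space \<pi>).
        rep_act \<pi> (g \<otimes>\<^bsub>G\<^esub> h) v = rep_act \<pi> g (rep_act \<pi> h v)) \<and>
     (\<forall>v\<in>carrier (rep_space \<pi>).
        continuous_map T (hilbert_topology (rep_space \<pi>)) (\<lambda>g. rep_act \<pi> g v))"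

text \<open>The zero representation is not irreducible.\<close>

definition irreducible_rep :: "('g, 'm) monoid_scheme \<Rightarrow> ('g, 'h) rep \<Rightarrow> bool" where
  "irreducible_rep G \<pi> \<longleftrightarrow>
     carrier (rep_space \<pi>) \<noteq> {\<zero>\<^bsub>rep_space \<pi>\<^esub>} \<and>
     (\<forall>W. submodule W complex_ring (rep_space \<pi>) \<and>
          closedin (hilbert_topology (rep_space \<pi>)) W \<and>
          (\<forall>g\<in>carrier G. rep_act \<pi> g ` W \<subseteq> W) \<longrightarrow>
          W = {\<zero>\<^bsub>rep_space \<pi>\<^esub>} \<or> W = carrier (rep_space \<pi>))"

definition rep_equivalent ::
    "('g, 'm) monoid_scheme \<Rightarrow> ('g, 'h) rep \<Rightarrow> ('g, 'k) rep \<Rightarrow> bool" where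
  "rep_equivalent G \<pi> \<rho> \<longleftrightarrow>
     (\<exists>U. unitary_map (rep_space \<pi>) (rep_space \<rho>) U \<and>
          (\<forall>g\<in>carrier G. \<forall>v\<in>carrier (rep_space \<pi>). U (rep_act \<pi> g v) = rep_act \<rho> g (U v)))"

text \<open>A representation of \<open>H / V\<close> regarded as a representation of \<open>H\<close>.\<close>

definition inflate :: "('g, 'm) monoid_scheme \<Rightarrow> 'g set \<Rightarrow> ('g set, 'h) rep \<Rightarrow> ('g, 'h) rep" where
  "inflate H V \<sigma> =
     \<lparr>rep_space = rep_space \<sigma>, rep_act = (\<lambda>h. rep_act \<sigma> (V #>\<^bsub>H\<^esub> h))\<rparr>"

text \<open>The representation \<open>\<sigma>\<^sup>g\<close> of \<open>g H g\<inverse>\<close>.\<close>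

definition conj_rep :: "('g, 'm) monoid_scheme \<Rightarrow> 'g \<Rightarrow> ('g, 'h) rep \<Rightarrow> ('g, 'h) rep" where
  "conj_rep G g \<sigma> =
     \<lparr>rep_space = rep_space \<sigma>,
      rep_act = (\<lambda>x. rep_act \<sigma> (inv\<^bsub>G\<^esub> g \<otimes>\<^bsub>G\<^esub> x \<otimes>\<^bsub>G\<^esub> g))\<rparr>"

section \<open>Induced representations\<close>

definition left_transversal :: "('g, 'm) monoid_scheme \<Rightarrow> 'g set \<Rightarrow> 'g set \<Rightarrow> bool" where
  "left_transversal G H R \<longleftrightarrow> R \<subseteq> carrier G \<and> (\<forall>C\<in>lcosets\<^bsub>G\<^esub> H. \<exists>!t. t \<in> R \<and> t \<in> C)"

text \<open>The induced representation does not depend on which transversal is chosen, since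
  \<open>\<langle>f(g), f'(g)\<rangle>\<close> depends only on the coset \<open>g H\<close>.\<close>

definition some_transversal :: "('g, 'm) monoid_scheme \<Rightarrow> 'g set \<Rightarrow> 'g set" where
  "some_transversal G H = (SOME R. left_transversal G H R)"

lemma (in group) left_transversal_some_transversal:
  assumes H: "subgroup H G"
  shows "left_transversal G H (some_transversal G H)"
proof -
  define r where "r C = (SOME x. x \<in> C)" for C :: "'a set"
  have r: "r C \<in> C" if C: "C \<in> lcosets H" for C
  proof -
    obtain a where "a \<in> carrier G" "C = a <# H"
      using C by (auto simp: LCOSETS_def)
    then have "a \<in> C"
      using subgroup.one_closed[OF H] by (force simp: l_coset_def)
    then show ?thesis unfolding r_def by (rule someI)
  qed
  have "\<Union>(lcosets H) = carrier G"
    by (rule lcosets_part_G[OF H])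
  moreover have "C = D" if "C \<in> lcosets H" "D \<in> lcosets H" "r D \<in> C" for C D
    using lcos_disjoint[OF H that(1,2)] that(3) r[OF that(2)] by auto
  ultimately have "left_transversal G H (r ` (lcosets H))"
    unfolding left_transversal_def using r by (intro conjI ballI ex1I) blast+
  then show ?thesis unfolding some_transversal_def by (rule someI)
qed

text \<open>Functions on \<open>G\<close> are represented by functions that are extensional on the carrier of
  \<open>G\<close>.\<close>

definition induced_space ::
    "('g, 'm) monoid_scheme \<Rightarrow> 'g set \<Rightarrow> ('g, 'h) rep \<Rightarrow> ('g \<Rightarrow> 'h) hilbert_space" where
  "induced_space G H \<sigma> =
     \<lparr>carrier =
        {f \<in> carrier G \<rightarrow>\<^sub>E carrier (rep_space \<sigma>).
           (\<forall>g\<in>carrier G. \<forall>h\<in>H. f (g \<otimes>\<^bsub>G\<^esub> h) = rep_act \<sigma> (inv\<^bsub>G\<^esub> h) (f g)) \<and>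
           (\<lambda>g. (hnorm (rep_space \<sigma>) (f g))\<^sup>2) summable_on some_transversal G H},
      monoid.mult = undefined,
      monoid.one = undefined,
      ring.zero = (\<lambda>g\<in>carrier G. \<zero>\<^bsub>rep_space \<sigma>\<^esub>),
      ring.add = (\<lambda>f f'. \<lambda>g\<in>carrier G. f g \<oplus>\<^bsub>rep_space \<sigma>\<^esub> f' g),
      module.smult = (\<lambda>c f. \<lambda>g\<in>carrier G. c \<odot>\<^bsub>rep_space \<sigma>\<^esub> f g),
      hinner = (\<lambda>f f'. \<Sum>\<^sub>\<infinity>g\<in>some_transversal G H. hinner (rep_space \<sigma>) (f g) (f' g))\<rparr>"

definition Ind :: "('g, 'm) monoid_scheme \<Rightarrow> 'g set \<Rightarrow> ('g, 'h) rep \<Rightarrow> ('g, 'g \<Rightarrow> 'h) rep" where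
  "Ind G H \<sigma> =
     \<lparr>rep_space = induced_space G H \<sigma>,
      rep_act = (\<lambda>g f. \<lambda>x\<in>carrier G. f (inv\<^bsub>G\<^esub> g \<otimes>\<^bsub>G\<^esub> x))\<rparr>"

end

theory Submission
  imports Defs
begin

text \<open>
  Let \<open>H\<close> be a commensurator with open normal subgroup \<open>V\<close>. Both parts rest on locating the
  \<open>V\<close>-fixed vectors in an induced representation, in the spirit of Mackey's criterion.

  On the side of the group, Roelcke precompactness makes \<open>V\<close> a subgroup of finite index in \<open>H\<close>
  (\<open>finite_coset_orbit_normal\<close>), and it provides only finitely many double cosets of open subgroups.
  From this one gets that the elements \<open>g\<close> for which \<open>g H\<close> has a finite \<open>H\<close>-orbit in \<open>G / H\<close> form
  a group (\<open>finite_coset_orbit_inv\<close>). A finite orbit of \<open>g H\<close> means that \<open>H \<inter> g H g\<inverse>\<close>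
  has finite index in \<open>H\<close>; applied to \<open>g\<close> and \<open>g\<inverse>\<close> this is commensurability, so \<open>g \<in> H\<close>
  (\<open>commensurator_finite_coset_orbit\<close>). For two commensurators \<open>A\<close> and \<open>B\<close>, finite orbits in both
  directions force \<open>A\<close> and \<open>B\<close> to be conjugate (\<open>commensurators_conjugate\<close>).

  On the side of the representation, a square summable function that is fixed by \<open>V\<close> has constant
  norm along \<open>V\<close>-orbits of cosets, so it lives on finite orbits (\<open>fixed_imp_finite_orbit\<close>). Hence the
  \<open>V\<close>-fixed vectors of \<open>Ind\<close> are the functions supported on \<open>H\<close>, which form a copy of \<open>\<sigma>\<close>.

  Irreducibility: a nonzero closed invariant subspace \<open>W\<close> contains a function \<open>f\<close> with \<open>f(\<one>) \<noteq> 0\<close>.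
  Among the elements of \<open>W\<close> with this value at \<open>\<one>\<close>, those of almost minimal norm are almost fixed by
  \<open>V\<close>, and they converge to the function supported on \<open>H\<close> with the given value
  (\<open>single_in_closed_invariant\<close>). So \<open>W\<close> meets the copy of \<open>\<sigma>\<close>; if \<open>\<sigma>\<close> is irreducible, \<open>W\<close> contains
  this copy, whose translates span a dense subspace. The converse holds because invariant subspaces
  of \<open>\<sigma>\<close> induce invariant subspaces of \<open>Ind\<close>.

  Equivalence: an intertwiner between two induced representations sends functions supported on \<open>H\<^sub>1\<close> to
  \<open>V\<^sub>1\<close>-fixed functions, so some coset of \<open>H\<^sub>2\<close> has a finite \<open>H\<^sub>1\<close>-orbit, and vice versa. Therefore the
  commensurators are conjugate, the finite orbit is a single coset, and evaluation at a point of it is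
  an equivalence of \<open>\<sigma>\<^sub>1\<close> with a conjugate of \<open>\<sigma>\<^sub>2\<close> (\<open>equivalent_Ind_imp_equivalent_conjugate\<close>).
  Conversely, right translation by the conjugating element intertwines the induced representations
  (\<open>equivalent_conjugate_imp_equivalent_Ind\<close>).
\<close>

(* The strict multiset order shares its symbol with left cosets. *)
no_notation subset_mset (infix "<#" 50)

section \<open>Finite orbits on coset spaces\<close>

context group
begin

lemma cancel_inv_left:
  assumes "x \<in> carrier G" and "y \<in> carrier G"
  shows "inv x \<otimes> (x \<otimes> y) = y" and "x \<otimes> (inv x \<otimes> y) = y"
  using assms by (simp_all add: m_assoc[symmetric])

text \<open>For subgroups \<open>A\<close> and \<open>B\<close> this orbit is finite exactly if \<open>A \<inter> g B g\<inverse>\<close> has finite index in \<open>A\<close>.\<close>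

definition coset_orbit :: "'a set \<Rightarrow> 'a \<Rightarrow> 'a set \<Rightarrow> 'a set set" where
  "coset_orbit A g B = (\<lambda>a. a \<otimes> g <# B) ` A"

lemma l_coset_eq_iff:
  assumes B: "subgroup B G" and x: "x \<in> carrier G" and y: "y \<in> carrier G"
  shows "x <# B = y <# B \<longleftrightarrow> inv x \<otimes> y \<in> B"
proof
  assume "x <# B = y <# B"
  moreover have "y \<in> y <# B"
    using lcos_self[OF y B] .
  ultimately obtain b where b: "b \<in> B" "y = x \<otimes> b"
    by (auto simp: l_coset_def)
  then show "inv x \<otimes> y \<in> B"
    using x subgroup.mem_carrier[OF B] by (auto simp: cancel_inv_left)
next
  assume *: "inv x \<otimes> y \<in> B"
  have "y = x \<otimes> (inv x \<otimes> y)"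
    using x y by (simp add: m_assoc[symmetric])
  then have "y \<in> x <# B"
    using * by (auto simp: l_coset_def)
  then show "x <# B = y <# B"
    using l_repr_independence[OF _ x B] by simp
qed

text \<open>If \<open>A g B\<close> consists of finitely many cosets \<open>x B\<close>, and \<open>B k C\<close> of finitely many cosets
  \<open>y C\<close>, then \<open>A g k C \<subseteq> A g B k C\<close> is covered by the finitely many cosets \<open>x y C\<close>.
  With \<open>g = \<one>\<close> and \<open>B\<close> of finite index in \<open>A\<close> this passes from \<open>B\<close>-orbits to \<open>A\<close>-orbits.\<close>

lemma finite_coset_orbit_trans:
  assumes A: "subgroup A G" and B: "subgroup B G" and C: "subgroup C G"
    and g: "g \<in> carrier G" and k: "k \<in> carrier G"
    and 1: "finite (coset_orbit A g B)" and 2: "finite (coset_orbit B k C)"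
  shows "finite (coset_orbit A (g \<otimes> k) C)"
proof -
  obtain A0 where A0: "A0 \<subseteq> A" "finite A0" "coset_orbit A g B = (\<lambda>a. a \<otimes> g <# B) ` A0"
    using finite_subset_image[OF 1, of "\<lambda>a. a \<otimes> g <# B" A] by (auto simp: coset_orbit_def)
  have "coset_orbit A (g \<otimes> k) C \<subseteq> (\<Union>a\<in>A0. (\<lambda>Y. a \<otimes> g <# Y) ` coset_orbit B k C)"
  proof
    fix Y assume "Y \<in> coset_orbit A (g \<otimes> k) C"
    then obtain a where a: "a \<in> A" "Y = a \<otimes> (g \<otimes> k) <# C"
      by (auto simp: coset_orbit_def)
    have "a \<otimes> g <# B \<in> coset_orbit A g B"
      using a by (auto simp: coset_orbit_def)
    then obtain a0 where a0: "a0 \<in> A0" "a \<otimes> g <# B = a0 \<otimes> g <# B"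
      using A0 by auto
    have c: "a \<in> carrier G" "a0 \<in> carrier G"
      using a a0 A0 subgroup.mem_carrier[OF A] by auto
    have "a \<otimes> g \<in> a0 \<otimes> g <# B"
      using lcos_self[of "a \<otimes> g" B] B a0 c g by auto
    then obtain b where b: "b \<in> B" "a \<otimes> g = a0 \<otimes> g \<otimes> b"
      by (auto simp: l_coset_def)
    have bc: "b \<in> carrier G"
      using b subgroup.mem_carrier[OF B] by auto
    have "a \<otimes> (g \<otimes> k) = a0 \<otimes> g \<otimes> (b \<otimes> k)"
      using b(2) bc c g k by (simp add: m_assoc[symmetric])
    then have "Y = a0 \<otimes> g <# (b \<otimes> k <# C)"
      using a(2) bc c g k subgroup.subset[OF C] by (simp add: lcos_m_assoc)
    then show "Y \<in> (\<Union>a\<in>A0. (\<lambda>Y. a \<otimes> g <# Y) ` coset_orbit B k C)"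
      using a0(1) b(1) by (auto simp: coset_orbit_def)
  qed
  then show ?thesis
    by (rule finite_subset) (use A0 2 in auto)
qed

text \<open>A coset \<open>a (A \<inter> B)\<close> with \<open>a \<in> A\<close> is the trace on \<open>A\<close> of \<open>a B\<close>, so the index of \<open>A \<inter> B\<close> in
  \<open>A\<close> is the size of the orbit of the trivial coset.\<close>

lemma finite_lcosets_Int:
  assumes A: "subgroup A G" and B: "subgroup B G" and fin: "finite (coset_orbit A \<one> B)"
  shows "finite (lcosets\<^bsub>G\<lparr>carrier := A\<rparr>\<^esub> (A \<inter> B))"
proof -
  have "a <# (A \<inter> B) = A \<inter> (a \<otimes> \<one> <# B)" if a: "a \<in> A" for a
  proof -
    have ac: "a \<in> carrier G"
      using subgroup.mem_carrier[OF A a] .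
    have "b \<in> A" if "b \<in> B" "a \<otimes> b \<in> A" for b
    proof -
      have "b = inv a \<otimes> (a \<otimes> b)"
        using ac subgroup.mem_carrier[OF B that(1)] by (simp add: m_assoc[symmetric])
      then show ?thesis
        using subgroup.m_closed[OF A subgroup.m_inv_closed[OF A a] that(2)] by simp
    qed
    then show ?thesis
      using ac a subgroup.m_closed[OF A] by (auto simp: l_coset_def)
  qed
  then have "lcosets\<^bsub>G\<lparr>carrier := A\<rparr>\<^esub> (A \<inter> B) \<subseteq> (\<lambda>Y. A \<inter> Y) ` coset_orbit A \<one> B"
    by (auto simp: LCOSETS_def l_coset_def coset_orbit_def)
  then show ?thesis
    using fin finite_surj by blast
qed

lemma mem_conjugate_iff:
  assumes H: "subgroup H G" and g: "g \<in> carrier G" and x: "x \<in> carrier G"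
  shows "x \<in> g <# H #> inv g \<longleftrightarrow> inv g \<otimes> x \<otimes> g \<in> H"
proof
  assume "x \<in> g <# H #> inv g"
  then obtain h where "h \<in> H" "x = g \<otimes> h \<otimes> inv g"
    by (auto simp: l_coset_def r_coset_def)
  moreover have "inv g \<otimes> (g \<otimes> h \<otimes> inv g) \<otimes> g = h" if "h \<in> H" for h
    using g subgroup.mem_carrier[OF H that] by (simp add: m_assoc cancel_inv_left)
  ultimately show "inv g \<otimes> x \<otimes> g \<in> H"
    by simp
next
  assume "inv g \<otimes> x \<otimes> g \<in> H"
  moreover have "x = g \<otimes> (inv g \<otimes> x \<otimes> g) \<otimes> inv g"
    using g x by (simp add: m_assoc cancel_inv_left)
  ultimately show "x \<in> g <# H #> inv g"
    by (auto simp: l_coset_def r_coset_def)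
qed

lemma subgroup_conjugate:
  assumes H: "subgroup H G" and g: "g \<in> carrier G"
  shows "subgroup (g <# H #> inv g) G"
proof (rule subgroupI)
  have sub: "g <# H #> inv g \<subseteq> carrier G"
    using g subgroup.subset[OF H] by (auto simp: l_coset_def r_coset_def)
  show "g <# H #> inv g \<subseteq> carrier G"
    by (rule sub)
  have "\<one> \<in> g <# H #> inv g"
    using g H by (simp add: mem_conjugate_iff subgroup.one_closed)
  then show "g <# H #> inv g \<noteq> {}"
    by blast
  fix a assume a: "a \<in> g <# H #> inv g"
  then have ac: "a \<in> carrier G" using sub by blast
  have "inv g \<otimes> inv a \<otimes> g = inv (inv g \<otimes> a \<otimes> g)"
    using ac g by (simp add: inv_mult_group m_assoc)
  then show "inv a \<in> g <# H #> inv g"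
    using a ac g H by (simp add: mem_conjugate_iff subgroup.m_inv_closed)
  fix b assume b: "b \<in> g <# H #> inv g"
  then have bc: "b \<in> carrier G" using sub by blast
  have "inv g \<otimes> (a \<otimes> b) \<otimes> g = (inv g \<otimes> a \<otimes> g) \<otimes> (inv g \<otimes> b \<otimes> g)"
    using ac bc g by (simp add: m_assoc cancel_inv_left)
  then show "a \<otimes> b \<in> g <# H #> inv g"
    using a b ac bc g H by (simp add: mem_conjugate_iff subgroup.m_closed)
qed

text \<open>With \<open>K = g H g\<inverse>\<close>, the \<open>H\<close>-orbit of \<open>g\<inverse> K = H g\<inverse>\<close> and the \<open>K\<close>-orbit of \<open>g H = K g\<close> are
  single points. Composing them with the two given orbits shows that the \<open>H\<close>-orbit of \<open>K\<close> and the
  \<open>K\<close>-orbit of \<open>H\<close> are finite, which says that \<open>H \<inter> K\<close> has finite index in both.\<close>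

lemma finite_coset_orbit_imp_Comm:
  assumes H: "subgroup H G" and g: "g \<in> carrier G"
    and fin: "finite (coset_orbit H g H)" "finite (coset_orbit H (inv g) H)"
  shows "g \<in> Comm G H"
proof -
  let ?K = "g <# H #> inv g"
  note K = subgroup_conjugate[OF H g]
  have eq: "h \<otimes> inv g <# ?K = inv g <# ?K" if h: "h \<in> H" for h
  proof -
    have hc: "h \<in> carrier G" using subgroup.mem_carrier[OF H h] .
    have "inv g \<otimes> (inv (h \<otimes> inv g) \<otimes> inv g) \<otimes> g = inv h"
      using g hc by (simp add: inv_mult_group m_assoc cancel_inv_left)
    then show ?thesis
      using g hc subgroup.m_inv_closed[OF H h] by (simp add: l_coset_eq_iff[OF K] mem_conjugate_iff[OF H])
  qed
  have "finite (coset_orbit H (inv g) ?K)"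
    unfolding coset_orbit_def by (rule finite_subset[of _ "{inv g <# ?K}"]) (use eq in auto)
  then have 1: "finite (coset_orbit H \<one> ?K)"
    using finite_coset_orbit_trans[OF H H K g inv_closed[OF g] fin(1)] g by simp
  have eq: "k \<otimes> g <# H = g <# H" if k: "k \<in> ?K" for k
  proof -
    have kc: "k \<in> carrier G" using subgroup.mem_carrier[OF K k] .
    have "inv (k \<otimes> g) \<otimes> g = inv (inv g \<otimes> k \<otimes> g)"
      using g kc by (simp add: inv_mult_group m_assoc)
    then show ?thesis
      using g kc k by (simp add: l_coset_eq_iff[OF H] mem_conjugate_iff[OF H] subgroup.m_inv_closed[OF H])
  qed
  have "finite (coset_orbit ?K g H)"
    unfolding coset_orbit_def by (rule finite_subset[of _ "{g <# H}"]) (use eq in auto)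
  then have 2: "finite (coset_orbit ?K \<one> H)"
    using finite_coset_orbit_trans[OF K H H g inv_closed[OF g] _ fin(2)] g by simp
  show ?thesis
    using finite_lcosets_Int[OF H K 1] finite_lcosets_Int[OF K H 2] g
    by (simp add: Comm_def commensurate_def Int_commute)
qed

text \<open>Roelcke precompactness applied to the neighbourhood \<open>A \<inter> B\<close> of the identity.\<close>

lemma finite_double_cosets:
  assumes rp: "roelcke_precompact G T"
    and A: "subgroup A G" "openin T A" and B: "subgroup B G" "openin T B"
  obtains F where "finite F" "F \<subseteq> carrier G"
    "\<And>g. g \<in> carrier G \<Longrightarrow> \<exists>a\<in>A. \<exists>f\<in>F. \<exists>b\<in>B. g = a \<otimes> f \<otimes> b"
proof -
  have "\<exists>F. finite F \<and> F \<subseteq> carrier G \<and> carrier G = (A \<inter> B) <#> F <#> (A \<inter> B)"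
    using rp subgroup.subset[OF A(1)] openin_Int[OF A(2) B(2)] subgroup.one_closed[OF A(1)]
      subgroup.one_closed[OF B(1)]
    unfolding roelcke_precompact_def by (metis IntI inf.coboundedI1 subset_refl)
  then obtain F where F: "finite F" "F \<subseteq> carrier G" "carrier G = (A \<inter> B) <#> F <#> (A \<inter> B)"
    by blast
  show ?thesis
  proof (rule that[OF F(1,2)])
    fix g assume "g \<in> carrier G"
    then show "\<exists>a\<in>A. \<exists>f\<in>F. \<exists>b\<in>B. g = a \<otimes> f \<otimes> b"
      unfolding F(3) set_mult_def by blast
  qed
qed

lemma coset_orbit_double_coset:
  assumes A: "subgroup A G" and B: "subgroup B G"
    and c: "a \<in> A" "f \<in> carrier G" "b \<in> B"
  shows "coset_orbit A (a \<otimes> f \<otimes> b) B = coset_orbit A f B"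
proof -
  have c': "a \<in> carrier G" "b \<in> carrier G"
    using c subgroup.mem_carrier[OF A] subgroup.mem_carrier[OF B] by auto
  have eq: "x \<otimes> (a \<otimes> f \<otimes> b) <# B = x \<otimes> a \<otimes> f <# B" if x: "x \<in> A" for x
  proof -
    have xc: "x \<in> carrier G" using subgroup.mem_carrier[OF A x] .
    have "inv (x \<otimes> (a \<otimes> f \<otimes> b)) \<otimes> (x \<otimes> a \<otimes> f) = inv b"
      using c c' xc by (simp add: inv_mult_group m_assoc cancel_inv_left)
    then show ?thesis
      using c c' xc subgroup.m_inv_closed[OF B c(3)] by (simp add: l_coset_eq_iff[OF B])
  qed
  have "(\<lambda>x. x \<otimes> a) ` A = A"
  proof
    show "(\<lambda>x. x \<otimes> a) ` A \<subseteq> A"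
      using c subgroup.m_closed[OF A] by auto
    show "A \<subseteq> (\<lambda>x. x \<otimes> a) ` A"
    proof
      fix x assume x: "x \<in> A"
      have "x = x \<otimes> inv a \<otimes> a"
        using c' subgroup.mem_carrier[OF A x] by (simp add: m_assoc)
      then show "x \<in> (\<lambda>x. x \<otimes> a) ` A"
        using x c subgroup.m_closed[OF A] subgroup.m_inv_closed[OF A] by blast
    qed
  qed
  then have "coset_orbit A f B = (\<lambda>x. x \<otimes> f <# B) ` ((\<lambda>x. x \<otimes> a) ` A)"
    by (simp only: coset_orbit_def)
  then have "coset_orbit A f B = (\<lambda>x. x \<otimes> a \<otimes> f <# B) ` A"
    by (simp only: image_image)
  then show ?thesis
    unfolding coset_orbit_def using eq by simp
qed

text \<open>An open normal subgroup \<open>V\<close> of \<open>H\<close> has finite index: in \<open>G = V F V\<close> an element of \<open>H\<close> can only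
  use a middle factor \<open>f \<in> F \<inter> H\<close>, and then \<open>V f V = f V\<close> by normality.\<close>

lemma finite_coset_orbit_normal:
  assumes rp: "roelcke_precompact G T"
    and H: "subgroup H G" and V: "V \<lhd> G\<lparr>carrier := H\<rparr>" "openin T V"
  shows "finite (coset_orbit H \<one> V)"
proof -
  interpret V: normal V "G\<lparr>carrier := H\<rparr>" by (rule V(1))
  interpret H: group "G\<lparr>carrier := H\<rparr>" by (rule subgroup.subgroup_is_group[OF H group_axioms])
  have VG: "subgroup V G"
    using incl_subgroup[OF H] V.subgroup_axioms by blast
  have VH: "V \<subseteq> H" using V.subset by simp
  obtain F where F: "finite F" "F \<subseteq> carrier G"
    "\<And>g. g \<in> carrier G \<Longrightarrow> \<exists>a\<in>V. \<exists>f\<in>F. \<exists>b\<in>V. g = a \<otimes> f \<otimes> b"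
    using finite_double_cosets[OF rp VG V(2) VG V(2)] by blast
  have "coset_orbit H \<one> V \<subseteq> (\<lambda>f. f <# V) ` F"
  proof
    fix Y assume "Y \<in> coset_orbit H \<one> V"
    then obtain h where h: "h \<in> H" "Y = h <# V"
      using subgroup.mem_carrier[OF H] by (auto simp: coset_orbit_def)
    have hc: "h \<in> carrier G" using subgroup.mem_carrier[OF H h(1)] .
    obtain a f b where f: "a \<in> V" "f \<in> F" "b \<in> V" "h = a \<otimes> f \<otimes> b"
      using F(3)[OF hc] by blast
    have c: "a \<in> carrier G" "b \<in> carrier G" "f \<in> carrier G" "a \<in> H" "b \<in> H"
      using f F(2) VH subgroup.mem_carrier[OF VG] by auto
    have "f = inv a \<otimes> h \<otimes> inv b"
      using c f(4) by (simp add: m_assoc cancel_inv_left)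
    then have fH: "f \<in> H"
      using c h(1) subgroup.m_closed[OF H] subgroup.m_inv_closed[OF H] by simp
    have "inv f \<otimes> a \<otimes> f \<in> V"
      using V.inv_op_closed1[of f a] f fH m_inv_consistent[OF H] by simp
    then have "inv f \<otimes> a \<otimes> f \<otimes> b \<in> V"
      using f(3) subgroup.m_closed[OF VG] by blast
    moreover have "inv f \<otimes> h = inv f \<otimes> a \<otimes> f \<otimes> b"
      using c f(4) by (simp add: m_assoc)
    ultimately have "f <# V = h <# V"
      using c hc by (simp add: l_coset_eq_iff[OF VG])
    then show "Y \<in> (\<lambda>f. f <# V) ` F"
      using f(2) h(2) by blast
  qed
  then show ?thesis
    using F(1) finite_surj by blast
qed

text \<open>Let \<open>S\<close> be the set of all \<open>x\<close> for which \<open>x H\<close> has a finite \<open>H\<close>-orbit. It is a submonoid of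
  \<open>G\<close>. There are finitely many \<open>(H, H)\<close> double cosets, so \<open>S\<close> is a union of finitely many
  cosets \<open>x H\<close>. Left multiplication by \<open>g \<in> S\<close> is an injection of this finite set of cosets into
  itself, hence a bijection; in particular the coset \<open>H\<close> is attained, which puts \<open>g\<inverse>\<close> into \<open>S\<close>.\<close>

lemma finite_coset_orbit_inv:
  assumes rp: "roelcke_precompact G T" and H: "subgroup H G" "openin T H"
    and g: "g \<in> carrier G" and fin: "finite (coset_orbit H g H)"
  shows "finite (coset_orbit H (inv g) H)"
proof -
  define S where "S = {x \<in> carrier G. finite (coset_orbit H x H)}"
  define C where "C = (\<lambda>x. x <# H) ` S"
  obtain F where F: "finite F" "F \<subseteq> carrier G"
    "\<And>g. g \<in> carrier G \<Longrightarrow> \<exists>a\<in>H. \<exists>f\<in>F. \<exists>b\<in>H. g = a \<otimes> f \<otimes> b"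
    using finite_double_cosets[OF rp H H] by blast
  \<comment> \<open>The finiteness of an orbit depends only on the double coset.\<close>
  have "C \<subseteq> (\<Union>f\<in>F \<inter> S. coset_orbit H f H)"
  proof
    fix Y assume "Y \<in> C"
    then obtain x where x: "x \<in> carrier G" "finite (coset_orbit H x H)" "Y = x <# H"
      by (auto simp: C_def S_def)
    obtain a f b where f: "a \<in> H" "f \<in> F" "b \<in> H" "x = a \<otimes> f \<otimes> b"
      using F(3)[OF x(1)] by blast
    have eq: "coset_orbit H x H = coset_orbit H f H"
      using coset_orbit_double_coset[OF H(1) H(1) f(1) _ f(3)] f F by auto
    have "\<one> \<otimes> x <# H \<in> coset_orbit H x H"
      using subgroup.one_closed[OF H(1)] unfolding coset_orbit_def by blast
    then have "Y \<in> coset_orbit H f H"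
      using x eq by simp
    then show "Y \<in> (\<Union>f\<in>F \<inter> S. coset_orbit H f H)"
      using f(2) F(2) x(2) eq by (auto simp: S_def)
  qed
  moreover have "finite (\<Union>f\<in>F \<inter> S. coset_orbit H f H)"
    using F(1) by (auto simp: S_def)
  ultimately have finC: "finite C"
    by (rule finite_subset)
  have gS: "g \<otimes> x \<in> S" if "x \<in> S" for x
    using that g finite_coset_orbit_trans[OF H(1) H(1) H(1) g _ fin] by (auto simp: S_def)
  have sub: "Y \<subseteq> carrier G" if "Y \<in> C" for Y
    using that l_coset_subset_G[OF subgroup.subset[OF H(1)]] by (auto simp: C_def S_def)
  have "(\<lambda>Y. g <# Y) ` C \<subseteq> C"
    using gS g by (auto simp: C_def S_def lcos_m_assoc subgroup.subset[OF H(1)])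
  moreover have "inj_on (\<lambda>Y. g <# Y) C"
  proof (rule inj_on_inverseI)
    fix Y assume "Y \<in> C"
    then show "inv g <# (g <# Y) = Y"
      using sub[of Y] g by (simp add: lcos_m_assoc lcos_mult_one)
  qed
  ultimately have "(\<lambda>Y. g <# Y) ` C = C"
    using endo_inj_surj[OF finC] by blast
  moreover have "\<one> \<in> S"
    using finite_subset[of "coset_orbit H \<one> H" "{H}"] coset_join3[OF _ H(1)] subgroup.mem_carrier[OF H(1)]
    by (auto simp: S_def coset_orbit_def)
  ultimately have "\<one> <# H \<in> (\<lambda>Y. g <# Y) ` C"
    unfolding C_def by blast
  then obtain x where x: "x \<in> S" "\<one> <# H = g <# (x <# H)"
    unfolding C_def by blast
  have xc: "x \<in> carrier G" using x(1) by (simp add: S_def)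
  have "\<one> <# H = g \<otimes> x <# H"
    using x(2) xc g subgroup.subset[OF H(1)] by (simp add: lcos_m_assoc)
  then have gx: "g \<otimes> x \<in> H"
    using xc g by (simp add: l_coset_eq_iff[OF H(1)])
  have "\<one> \<otimes> x \<otimes> inv (g \<otimes> x) = inv g"
    using xc g by (simp add: inv_mult_group m_assoc[symmetric])
  then have "coset_orbit H (inv g) H = coset_orbit H x H"
    using coset_orbit_double_coset[OF H(1) H(1) subgroup.one_closed[OF H(1)] xc
        subgroup.m_inv_closed[OF H(1) gx]] by simp
  then show ?thesis
    using x(1) by (simp add: S_def)
qed

lemma commensurator_finite_coset_orbit:
  assumes rp: "roelcke_precompact G T" and H: "commensurator G T H"
    and g: "g \<in> carrier G" and fin: "finite (coset_orbit H g H)"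
  shows "g \<in> H"
  using H finite_coset_orbit_imp_Comm[OF _ g fin] finite_coset_orbit_inv[OF rp _ _ g fin]
  unfolding commensurator_def by blast

text \<open>A finite \<open>A\<close>-orbit of \<open>x B\<close> composes with a finite \<open>B\<close>-orbit of \<open>y A\<close> to a finite \<open>A\<close>-orbit of
  \<open>x y A\<close>, so \<open>x y \<in> A\<close>, and symmetrically \<open>y x \<in> B\<close>. The orbits do not change if \<open>x\<close> is
  multiplied by elements of \<open>A\<close> and \<open>B\<close>; hence \<open>g B k \<subseteq> A\<close> and \<open>k A g \<subseteq> B\<close>, and these inclusions
  combine to \<open>A = g B g\<inverse>\<close>.\<close>

lemma commensurators_conjugate:
  assumes rp: "roelcke_precompact G T" and A: "commensurator G T A" and B: "commensurator G T B"
    and g: "g \<in> carrier G" "finite (coset_orbit A g B)"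
    and k: "k \<in> carrier G" "finite (coset_orbit B k A)"
  shows "A = g <# B #> inv g" and "g \<otimes> k \<in> A"
proof -
  have sA: "subgroup A G" and sB: "subgroup B G"
    using A B by (auto simp: commensurator_def)
  have AB: "x \<otimes> y \<in> A" if "x \<in> carrier G" "finite (coset_orbit A x B)"
    "y \<in> carrier G" "finite (coset_orbit B y A)" for x y
    using commensurator_finite_coset_orbit[OF rp A _ finite_coset_orbit_trans[OF sA sB sA that(1,3,2,4)]]
      that by simp
  have BA: "y \<otimes> x \<in> B" if "x \<in> carrier G" "finite (coset_orbit A x B)"
    "y \<in> carrier G" "finite (coset_orbit B y A)" for x y
    using commensurator_finite_coset_orbit[OF rp B _ finite_coset_orbit_trans[OF sB sA sB that(3,1,4,2)]]
      that by simp
  show gk: "g \<otimes> k \<in> A"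
    using AB g k by blast
  have kg: "k \<otimes> g \<in> B"
    using BA g k by blast
  show "A = g <# B #> inv g"
  proof
    show "A \<subseteq> g <# B #> inv g"
    proof
      fix a assume a: "a \<in> A"
      have ac: "a \<in> carrier G" using subgroup.mem_carrier[OF sA a] .
      have "coset_orbit B (k \<otimes> a) A = coset_orbit B k A"
        using coset_orbit_double_coset[OF sB sA subgroup.one_closed[OF sB] k(1) a] k by simp
      then have "k \<otimes> a \<otimes> g \<in> B"
        using BA[of g "k \<otimes> a"] g k ac by simp
      then have "inv (k \<otimes> g) \<otimes> (k \<otimes> a \<otimes> g) \<in> B"
        using subgroup.m_closed[OF sB subgroup.m_inv_closed[OF sB kg]] by blast
      moreover have "inv (k \<otimes> g) \<otimes> (k \<otimes> a \<otimes> g) = inv g \<otimes> a \<otimes> g"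
        using g k ac by (simp add: inv_mult_group m_assoc cancel_inv_left)
      ultimately show "a \<in> g <# B #> inv g"
        using g ac by (simp add: mem_conjugate_iff[OF sB])
    qed
    show "g <# B #> inv g \<subseteq> A"
    proof
      fix x assume x: "x \<in> g <# B #> inv g"
      then have xc: "x \<in> carrier G"
        using subgroup.mem_carrier[OF subgroup_conjugate[OF sB g(1)]] by blast
      define b where "b = inv g \<otimes> x \<otimes> g"
      have b: "b \<in> B" "b \<in> carrier G"
        using x g xc by (simp_all add: mem_conjugate_iff[OF sB] b_def)
      have "coset_orbit A (g \<otimes> b) B = coset_orbit A g B"
        using coset_orbit_double_coset[OF sA sB subgroup.one_closed[OF sA] g(1) b(1)] g by simp
      then have "g \<otimes> b \<otimes> k \<in> A"
        using AB[of "g \<otimes> b" k] g k b by simp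
      then have "g \<otimes> b \<otimes> k \<otimes> inv (g \<otimes> k) \<in> A"
        using subgroup.m_closed[OF sA _ subgroup.m_inv_closed[OF sA gk]] by blast
      moreover have "g \<otimes> b \<otimes> k \<otimes> inv (g \<otimes> k) = x"
        using g k xc unfolding b_def by (simp add: inv_mult_group m_assoc cancel_inv_left)
      ultimately show "x \<in> A" by simp
    qed
  qed
qed

end

section \<open>Inner product spaces\<close>

lemma complex_ring_simps [simp]:
  "carrier complex_ring = UNIV" "a \<otimes>\<^bsub>complex_ring\<^esub> b = a * b" "a \<oplus>\<^bsub>complex_ring\<^esub> b = a + b"
  "\<one>\<^bsub>complex_ring\<^esub> = 1" "\<zero>\<^bsub>complex_ring\<^esub> = 0"
  by (simp_all add: ring_of_type_algebra_def)

text \<open>The structure in which the arguments on induced spaces run: every limit that is taken in an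
  induced space below is exhibited explicitly.\<close>

locale complex_inner_space =
  Module.module complex_ring E for E :: "('h, 'm) hilbert_space_scheme" (structure) +
  assumes hinner_add:
      "\<lbrakk>x \<in> carrier E; y \<in> carrier E; z \<in> carrier E\<rbrakk>
        \<Longrightarrow> hinner E (x \<oplus> y) z = hinner E x z + hinner E y z"
    and hinner_smult:
      "\<lbrakk>x \<in> carrier E; y \<in> carrier E\<rbrakk> \<Longrightarrow> hinner E (c \<odot> x) y = c * hinner E x y"
    and hinner_commute:
      "\<lbrakk>x \<in> carrier E; y \<in> carrier E\<rbrakk> \<Longrightarrow> hinner E y x = cnj (hinner E x y)"
    and hinner_nonneg: "x \<in> carrier E \<Longrightarrow> 0 \<le> Re (hinner E x x)"
    and hinner_definite: "\<lbrakk>x \<in> carrier E; hinner E x x = 0\<rbrakk> \<Longrightarrow> x = \<zero>"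

sublocale complex_hilbert_space \<subseteq> complex_inner_space
  by unfold_locales (auto intro: hinner_add hinner_smult hinner_commute hinner_nonneg hinner_definite)

context complex_inner_space
begin

lemma smult_carrier [simp, intro]: "x \<in> carrier E \<Longrightarrow> c \<odot> x \<in> carrier E"
  using smult_closed[of c x] by simp

lemma hinner_add_right:
  "\<lbrakk>x \<in> carrier E; y \<in> carrier E; z \<in> carrier E\<rbrakk>
    \<Longrightarrow> hinner E z (x \<oplus> y) = hinner E z x + hinner E z y"
  using hinner_add[of x y z] hinner_commute[of "x \<oplus> y" z] hinner_commute[of x z] hinner_commute[of y z]
  by simp

lemma hinner_smult_right:
  "\<lbrakk>x \<in> carrier E; y \<in> carrier E\<rbrakk> \<Longrightarrow> hinner E y (c \<odot> x) = cnj c * hinner E y x"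
  using hinner_smult[of x y c] hinner_commute[of "c \<odot> x" y] hinner_commute[of x y] by simp

lemma smult_uminus_1: "x \<in> carrier E \<Longrightarrow> (- 1) \<odot> x = \<ominus> x"
proof -
  assume x: "x \<in> carrier E"
  have "(- 1) \<odot> x \<oplus> x = (- 1 \<oplus>\<^bsub>complex_ring\<^esub> 1) \<odot> x"
    using x smult_l_distr[of "- 1" 1 x] smult_one[of x] by simp
  also have "\<dots> = \<zero>"
    using x smult_l_null[of x] by simp
  finally show ?thesis
    using x by (simp add: M.minus_equality)
qed

lemma minus_conv_smult: "\<lbrakk>x \<in> carrier E; y \<in> carrier E\<rbrakk> \<Longrightarrow> x \<ominus> y = x \<oplus> (- 1) \<odot> y"
  by (simp add: smult_uminus_1 M.minus_eq)

lemma minus_eq_zero_iff: "\<lbrakk>x \<in> carrier E; y \<in> carrier E\<rbrakk> \<Longrightarrow> x \<ominus> y = \<zero> \<longleftrightarrow> x = y"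
  by (metis M.minus_eq M.a_inv_closed M.minus_equality M.minus_minus M.r_neg M.a_comm)

lemma hinner_self: "x \<in> carrier E \<Longrightarrow> hinner E x x = of_real (Re (hinner E x x))"
  using hinner_commute[of x x] by (simp add: complex_eq_iff)

lemma hnorm_power2: "x \<in> carrier E \<Longrightarrow> (hnorm E x)\<^sup>2 = Re (hinner E x x)"
  using hinner_nonneg by (simp add: hnorm_def)

lemma hnorm_nonneg [simp]: "x \<in> carrier E \<Longrightarrow> 0 \<le> hnorm E x"
  using hinner_nonneg by (simp add: hnorm_def)

lemma hinner_zero [simp]: "x \<in> carrier E \<Longrightarrow> hinner E \<zero> x = 0" "x \<in> carrier E \<Longrightarrow> hinner E x \<zero> = 0"
  using hinner_smult[of \<zero> x 0] hinner_commute[of \<zero> x] smult_l_null[of \<zero>] by simp_all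

lemma hnorm_eq_0_iff [simp]: "x \<in> carrier E \<Longrightarrow> hnorm E x = 0 \<longleftrightarrow> x = \<zero>"
  using hinner_definite[of x] hinner_self[of x] by (auto simp: hnorm_def)

lemma hnorm_zero [simp]: "hnorm E \<zero> = 0"
  by simp

lemma hnorm_power2_smult: "x \<in> carrier E \<Longrightarrow> (hnorm E (c \<odot> x))\<^sup>2 = (cmod c)\<^sup>2 * (hnorm E x)\<^sup>2"
proof -
  assume x: "x \<in> carrier E"
  have "hinner E (c \<odot> x) (c \<odot> x) = c * cnj c * hinner E x x"
    using x by (simp add: hinner_smult hinner_smult_right)
  also have "\<dots> = of_real ((cmod c)\<^sup>2 * Re (hinner E x x))"
    using hinner_self[OF x] by (metis complex_norm_square of_real_mult)
  finally show ?thesis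
    using x by (simp add: hnorm_power2)
qed

lemma hnorm_power2_add:
  "\<lbrakk>x \<in> carrier E; y \<in> carrier E\<rbrakk>
    \<Longrightarrow> (hnorm E (x \<oplus> y))\<^sup>2 = (hnorm E x)\<^sup>2 + (hnorm E y)\<^sup>2 + 2 * Re (hinner E x y)"
  using hinner_commute[of x y] by (simp add: hnorm_power2 hinner_add hinner_add_right)

lemma hnorm_power2_minus:
  "\<lbrakk>x \<in> carrier E; y \<in> carrier E\<rbrakk>
    \<Longrightarrow> (hnorm E (x \<ominus> y))\<^sup>2 = (hnorm E x)\<^sup>2 + (hnorm E y)\<^sup>2 - 2 * Re (hinner E x y)"
  by (simp add: minus_conv_smult hnorm_power2_add hnorm_power2_smult hinner_smult_right)

lemma parallelogram:
  "\<lbrakk>x \<in> carrier E; y \<in> carrier E\<rbrakk>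
    \<Longrightarrow> (hnorm E (x \<oplus> y))\<^sup>2 + (hnorm E (x \<ominus> y))\<^sup>2 = 2 * (hnorm E x)\<^sup>2 + 2 * (hnorm E y)\<^sup>2"
  by (simp add: hnorm_power2_add hnorm_power2_minus)

lemma hnorm_power2_add_le:
  "\<lbrakk>x \<in> carrier E; y \<in> carrier E\<rbrakk> \<Longrightarrow> (hnorm E (x \<oplus> y))\<^sup>2 \<le> 2 * (hnorm E x)\<^sup>2 + 2 * (hnorm E y)\<^sup>2"
  using parallelogram[of x y] zero_le_power2[of "hnorm E (x \<ominus> y)"] by linarith

lemma hnorm_power2_le_minus:
  assumes x: "x \<in> carrier E" and y: "y \<in> carrier E"
  shows "(hnorm E x)\<^sup>2 \<le> 2 * (hnorm E (x \<ominus> y))\<^sup>2 + 2 * (hnorm E y)\<^sup>2"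
proof -
  have "x = (x \<ominus> y) \<oplus> y"
    using x y by (simp add: M.minus_eq M.a_assoc M.l_neg)
  then show ?thesis
    using hnorm_power2_add_le[of "x \<ominus> y" y] x y by simp
qed

lemma cauchy_schwarz:
  assumes x: "x \<in> carrier E" and y: "y \<in> carrier E"
  shows "cmod (hinner E x y) \<le> hnorm E x * hnorm E y"
proof (cases "y = \<zero>")
  case True
  then show ?thesis using x by simp
next
  case False
  let ?p = "hinner E x y" and ?n = "(hnorm E y)\<^sup>2"
  have n: "?n > 0"
    using False y by simp
  \<comment> \<open>The vector \<open>x + c y\<close> is the component of \<open>x\<close> orthogonal to \<open>y\<close>.\<close>
  define c where "c = - ?p / of_real ?n"
  have "Re (cnj c * ?p) = - (cmod ?p)\<^sup>2 / ?n"
    unfolding c_def using cmod_power2[of ?p] by (simp add: power2_eq_square add_divide_distrib diff_divide_distrib)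
  moreover have "cmod c = cmod ?p / ?n"
    unfolding c_def by (simp add: norm_divide norm_power)
  then have "(cmod c)\<^sup>2 * ?n = (cmod ?p)\<^sup>2 / ?n"
    using n by (simp add: power2_eq_square)
  ultimately have "(hnorm E (x \<oplus> c \<odot> y))\<^sup>2 = (hnorm E x)\<^sup>2 - (cmod ?p)\<^sup>2 / ?n"
    using x y by (simp add: hnorm_power2_add hnorm_power2_smult hinner_smult_right)
  then have "(cmod ?p)\<^sup>2 / ?n \<le> (hnorm E x)\<^sup>2"
    using zero_le_power2[of "hnorm E (x \<oplus> c \<odot> y)"] by linarith
  then have "(cmod ?p)\<^sup>2 \<le> (hnorm E x * hnorm E y)\<^sup>2"
    using n by (simp add: divide_simps power_mult_distrib split: if_splits)
  then show ?thesis
    by (rule power2_le_imp_le) (use x y in simp)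
qed

lemma hnorm_triangle:
  assumes x: "x \<in> carrier E" and y: "y \<in> carrier E"
  shows "hnorm E (x \<oplus> y) \<le> hnorm E x + hnorm E y"
proof -
  have "Re (hinner E x y) \<le> hnorm E x * hnorm E y"
    using cauchy_schwarz[OF x y] complex_Re_le_cmod order_trans by blast
  then have "(hnorm E (x \<oplus> y))\<^sup>2 \<le> (hnorm E x + hnorm E y)\<^sup>2"
    using x y by (simp add: hnorm_power2_add power2_sum)
  then show ?thesis
    by (rule power2_le_imp_le) (use x y in simp)
qed

sublocale Metric_space "carrier E" "hdist E"
proof
  have comm: "hnorm E (x \<ominus> y) = hnorm E (y \<ominus> x)" if "x \<in> carrier E" "y \<in> carrier E" for x y
  proof -
    have "(hnorm E (x \<ominus> y))\<^sup>2 = (hnorm E (y \<ominus> x))\<^sup>2"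
      using that hinner_commute[of x y] by (simp add: hnorm_power2_minus)
    then show ?thesis
      using that by simp
  qed
  show "0 \<le> hdist E x y" for x y
    by (simp add: hdist_def)
  show "hdist E x y = hdist E y x" for x y
    using comm by (simp add: hdist_def)
  show "hdist E x y = 0 \<longleftrightarrow> x = y" if "x \<in> carrier E" "y \<in> carrier E" for x y
    using that by (simp add: hdist_def minus_eq_zero_iff)
  show "hdist E x z \<le> hdist E x y + hdist E y z"
    if "x \<in> carrier E" "y \<in> carrier E" "z \<in> carrier E" for x y z
  proof -
    have "x \<ominus> z = (x \<ominus> y) \<oplus> (y \<ominus> z)"
      using that M.a_assoc[of "\<ominus> y" y "\<ominus> z"] by (simp add: M.minus_eq M.a_assoc M.l_neg)
    then show ?thesis
      using that hnorm_triangle[of "x \<ominus> y" "y \<ominus> z"] by (simp add: hdist_def)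
  qed
qed

text \<open>Closedness in terms of squared norms, which are what the sums over a transversal compute.\<close>

lemma closedin_iff_approximable:
  "closedin (hilbert_topology E) W \<longleftrightarrow> W \<subseteq> carrier E \<and>
     (\<forall>x\<in>carrier E. (\<forall>e>0. \<exists>w\<in>W. (hnorm E (x \<ominus> w))\<^sup>2 < e) \<longrightarrow> x \<in> W)"
proof (cases "W \<subseteq> carrier E")
  case True
  have "(\<exists>r>0. disjnt W (mball x r)) \<longleftrightarrow> \<not> (\<forall>e>0. \<exists>w\<in>W. (hnorm E (x \<ominus> w))\<^sup>2 < e)"
    if x: "x \<in> carrier E" for x
  proof
    assume "\<exists>r>0. disjnt W (mball x r)"
    then obtain r where r: "r > 0" "disjnt W (mball x r)"
      by blast
    have "\<not> (hnorm E (x \<ominus> w))\<^sup>2 < r\<^sup>2" if w: "w \<in> W" for w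
    proof
      assume "(hnorm E (x \<ominus> w))\<^sup>2 < r\<^sup>2"
      then have "hnorm E (x \<ominus> w) < r"
        using r by (simp add: power_less_imp_less_base)
      then have "w \<in> mball x r"
        using w x True by (auto simp: hdist_def)
      then show False
        using r(2) w by (auto simp: disjnt_iff)
    qed
    moreover have "r\<^sup>2 > 0"
      using r(1) by simp
    ultimately show "\<not> (\<forall>e>0. \<exists>w\<in>W. (hnorm E (x \<ominus> w))\<^sup>2 < e)"
      by blast
  next
    assume "\<not> (\<forall>e>0. \<exists>w\<in>W. (hnorm E (x \<ominus> w))\<^sup>2 < e)"
    then obtain e where e: "e > 0" "\<And>w. w \<in> W \<Longrightarrow> \<not> (hnorm E (x \<ominus> w))\<^sup>2 < e"
      by blast
    have "w \<notin> mball x (sqrt e)" if w: "w \<in> W" for w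
    proof
      assume "w \<in> mball x (sqrt e)"
      then have "hnorm E (x \<ominus> w) < sqrt e"
        using w x True by (auto simp: hdist_def)
      then have "(hnorm E (x \<ominus> w))\<^sup>2 < (sqrt e)\<^sup>2"
        by (rule power_strict_mono) (use w x True in auto)
      then show False
        using e w by simp
    qed
    then have "disjnt W (mball x (sqrt e))"
      by (auto simp: disjnt_iff)
    moreover have "sqrt e > 0"
      using e(1) by simp
    ultimately show "\<exists>r>0. disjnt W (mball x r)"
      by blast
  qed
  then show ?thesis
    using True unfolding closedin_metric by blast
next
  case False
  then show ?thesis
    unfolding closedin_metric by blast
qed

end

section \<open>Functions on cosets and the space of an induced representation\<close>

context group
begin

text \<open>Both transversals are in bijection with the set of cosets. The bijection moves an element only
  within its coset, which makes sums of \<open>H\<close>-invariant functions comparable.\<close>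

lemma bij_betw_left_transversals:
  assumes H: "subgroup H G" and R: "left_transversal G H R" and R': "left_transversal G H R'"
  obtains p where "bij_betw p R' R" "\<And>x. x \<in> R' \<Longrightarrow> \<exists>h\<in>H. p x = x \<otimes> h"
proof -
  have ex: "\<exists>!t. t \<in> Q \<and> t \<in> x <# H" if "left_transversal G H Q" "x \<in> carrier G" for Q x
    using that by (auto simp: left_transversal_def LCOSETS_def)
  define p where "p Q x = (THE t. t \<in> Q \<and> t \<in> x <# H)" for Q x
  have p: "p Q x \<in> Q" "p Q x \<in> x <# H" if "left_transversal G H Q" "x \<in> carrier G" for Q x
    using theI'[OF ex[OF that]] by (auto simp: p_def)
  have p_eq: "p Q x = t" if "left_transversal G H Q" "x \<in> carrier G" "t \<in> Q" "t \<in> x <# H" for Q x t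
    using ex[OF that(1,2)] p[OF that(1,2)] that(3,4) by blast
  have sub: "Q \<subseteq> carrier G" if "left_transversal G H Q" for Q
    using that by (auto simp: left_transversal_def)
  have inv: "p Q (p Q' x) = x"
    if Q: "left_transversal G H Q" "left_transversal G H Q'" and x: "x \<in> Q" for Q Q' x
  proof (rule p_eq[OF Q(1) _ x])
    show "p Q' x \<in> carrier G"
      using p[OF Q(2)] sub[OF Q(1)] sub[OF Q(2)] x by blast
    show "x \<in> p Q' x <# H"
      using l_coset_swap[OF p(2)[OF Q(2)] _ H] sub[OF Q(1)] x by blast
  qed
  have "bij_betw (p R) R' R"
    by (rule bij_betw_byWitness[where f' = "p R'"]) (use inv R R' p sub in blast)+
  moreover have "\<exists>h\<in>H. p R x = x \<otimes> h" if "x \<in> R'" for x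
    using p(2)[OF R] sub[OF R'] that by (auto simp: l_coset_def)
  ultimately show ?thesis
    using that by blast
qed

lemma
  fixes F :: "'a \<Rightarrow> 'c :: {comm_monoid_add, t2_space}"
  assumes H: "subgroup H G" and R: "left_transversal G H R" and R': "left_transversal G H R'"
    and F: "\<And>x h. x \<in> carrier G \<Longrightarrow> h \<in> H \<Longrightarrow> F (x \<otimes> h) = F x"
  shows summable_on_left_transversal_cong: "F summable_on R \<longleftrightarrow> F summable_on R'"
    and infsum_left_transversal_cong: "infsum F R = infsum F R'"
proof -
  obtain p where p: "bij_betw p R' R" "\<And>x. x \<in> R' \<Longrightarrow> \<exists>h\<in>H. p x = x \<otimes> h"
    using bij_betw_left_transversals[OF H R R'] by blast
  have "R' \<subseteq> carrier G"
    using R' by (simp add: left_transversal_def)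
  then have eq: "F (p x) = F x" if "x \<in> R'" for x
    using p(2)[OF that] F that by auto
  show "F summable_on R \<longleftrightarrow> F summable_on R'"
    using summable_on_reindex_bij_betw[OF p(1), of F] summable_on_cong[of R' "\<lambda>x. F (p x)" F] eq by simp
  show "infsum F R = infsum F R'"
    using infsum_reindex_bij_betw[OF p(1), of F] infsum_cong[of R' "\<lambda>x. F (p x)" F] eq by simp
qed

lemma left_transversal_iff:
  assumes H: "subgroup H G"
  shows "left_transversal G H R \<longleftrightarrow> R \<subseteq> carrier G \<and>
    (\<forall>x\<in>carrier G. \<exists>t\<in>R. \<exists>h\<in>H. x = t \<otimes> h) \<and> (\<forall>s\<in>R. \<forall>t\<in>R. inv s \<otimes> t \<in> H \<longrightarrow> s = t)"
  (is "_ \<longleftrightarrow> _ \<and> ?ex \<and> ?un")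
proof (cases "R \<subseteq> carrier G")
  case True
  have mem: "t \<in> x <# H \<longleftrightarrow> inv x \<otimes> t \<in> H" if "x \<in> carrier G" "t \<in> carrier G" for x t
    using that l_coset_eq_iff[OF H, of x t] lcos_self[of t H] H l_repr_independence[of t x H] by auto
  have ex: "(\<exists>h\<in>H. x = t \<otimes> h) \<longleftrightarrow> t \<in> x <# H" if "x \<in> carrier G" "t \<in> carrier G" for x t
    using that l_coset_swap[OF _ _ H, of t x] l_coset_swap[OF _ _ H, of x t] by (auto simp: l_coset_def)
  have "left_transversal G H R \<longleftrightarrow> (\<forall>x\<in>carrier G. \<exists>!t. t \<in> R \<and> t \<in> x <# H)"
    using True by (auto simp: left_transversal_def LCOSETS_def)
  also have "\<dots> \<longleftrightarrow> (\<forall>x\<in>carrier G. \<exists>t\<in>R. t \<in> x <# H) \<and>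
      (\<forall>x\<in>carrier G. \<forall>s\<in>R. \<forall>t\<in>R. s \<in> x <# H \<longrightarrow> t \<in> x <# H \<longrightarrow> s = t)"
    by blast
  also have "(\<forall>x\<in>carrier G. \<exists>t\<in>R. t \<in> x <# H) \<longleftrightarrow> ?ex"
    using True ex by (meson subsetD)
  also have "(\<forall>x\<in>carrier G. \<forall>s\<in>R. \<forall>t\<in>R. s \<in> x <# H \<longrightarrow> t \<in> x <# H \<longrightarrow> s = t) \<longleftrightarrow> ?un"
  proof (intro iffI ballI impI)
    fix s t assume *: "\<forall>x\<in>carrier G. \<forall>s\<in>R. \<forall>t\<in>R. s \<in> x <# H \<longrightarrow> t \<in> x <# H \<longrightarrow> s = t"
      and st: "s \<in> R" "t \<in> R" "inv s \<otimes> t \<in> H"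
    then show "s = t"
      using True mem[of s t] lcos_self[OF _ H, of s] by blast
  next
    fix x s t assume un: ?un and x: "x \<in> carrier G" and st: "s \<in> R" "t \<in> R" "s \<in> x <# H" "t \<in> x <# H"
    have "t <# H = s <# H"
      using l_repr_independence[OF st(3) x H] l_repr_independence[OF st(4) x H] by simp
    then show "s = t"
      using un st True l_coset_eq_iff[OF H, of s t] by auto
  qed
  finally show ?thesis
    using True by blast
qed (auto simp: left_transversal_def)

end

locale subgroup_rep = group G + H: subgroup H G + E: complex_inner_space "rep_space \<rho>"
  for G :: "('g, 'm) monoid_scheme" (structure) and H and \<rho> :: "('g, 'h) rep" +
  assumes act_unitary: "h \<in> H \<Longrightarrow> unitary_map (rep_space \<rho>) (rep_space \<rho>) (rep_act \<rho> h)"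
    and act_mult: "\<lbrakk>g \<in> H; h \<in> H; v \<in> carrier (rep_space \<rho>)\<rbrakk>
      \<Longrightarrow> rep_act \<rho> (g \<otimes> h) v = rep_act \<rho> g (rep_act \<rho> h v)"
begin

abbreviation "E \<equiv> rep_space \<rho>"
abbreviation "R \<equiv> some_transversal G H"
abbreviation "I \<equiv> induced_space G H \<rho>"
abbreviation "tr \<equiv> rep_act (Ind G H \<rho>)"

lemma H_subgroup: "subgroup H G" ..

lemma H_carrier [simp, intro]: "h \<in> H \<Longrightarrow> h \<in> carrier G"
  by (rule H.mem_carrier)

lemma act_closed [simp, intro]: "\<lbrakk>h \<in> H; v \<in> carrier E\<rbrakk> \<Longrightarrow> rep_act \<rho> h v \<in> carrier E"
  using bij_betwE act_unitary unfolding unitary_map_def by metis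

lemma act_add: "\<lbrakk>h \<in> H; v \<in> carrier E; w \<in> carrier E\<rbrakk>
    \<Longrightarrow> rep_act \<rho> h (v \<oplus>\<^bsub>E\<^esub> w) = rep_act \<rho> h v \<oplus>\<^bsub>E\<^esub> rep_act \<rho> h w"
  using act_unitary[of h] unfolding unitary_map_def by blast

lemma act_smult: "\<lbrakk>h \<in> H; v \<in> carrier E\<rbrakk> \<Longrightarrow> rep_act \<rho> h (c \<odot>\<^bsub>E\<^esub> v) = c \<odot>\<^bsub>E\<^esub> rep_act \<rho> h v"
  using act_unitary[of h] unfolding unitary_map_def by blast

lemma act_hinner: "\<lbrakk>h \<in> H; v \<in> carrier E; w \<in> carrier E\<rbrakk>
    \<Longrightarrow> hinner E (rep_act \<rho> h v) (rep_act \<rho> h w) = hinner E v w"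
  using act_unitary[of h] unfolding unitary_map_def by blast

lemma act_hnorm: "\<lbrakk>h \<in> H; v \<in> carrier E\<rbrakk> \<Longrightarrow> hnorm E (rep_act \<rho> h v) = hnorm E v"
  by (simp add: hnorm_def act_hinner)

lemma act_zero: "h \<in> H \<Longrightarrow> rep_act \<rho> h \<zero>\<^bsub>E\<^esub> = \<zero>\<^bsub>E\<^esub>"
  using act_hnorm[of h "\<zero>\<^bsub>E\<^esub>"] by simp

lemma act_one [simp]: "v \<in> carrier E \<Longrightarrow> rep_act \<rho> \<one> v = v"
proof -
  assume v: "v \<in> carrier E"
  have "inj_on (rep_act \<rho> \<one>) (carrier E)"
    using act_unitary[OF H.one_closed] unfolding unitary_map_def bij_betw_def by blast
  moreover have "rep_act \<rho> \<one> (rep_act \<rho> \<one> v) = rep_act \<rho> \<one> v"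
    using act_mult[of \<one> \<one> v] v by simp
  ultimately show ?thesis
    using v by (auto dest: inj_onD)
qed

lemma left_transversal_R: "left_transversal G H R"
  by (rule left_transversal_some_transversal[OF H_subgroup])

lemma R_carrier [simp, intro]: "t \<in> R \<Longrightarrow> t \<in> carrier G"
  using left_transversal_R by (auto simp: left_transversal_def)

lemma R_cases:
  assumes "x \<in> carrier G"
  obtains t h where "t \<in> R" "h \<in> H" "x = t \<otimes> h"
  using left_transversal_R assms that unfolding left_transversal_iff[OF H_subgroup] by blast

lemma R_unique: "\<lbrakk>s \<in> R; t \<in> R; inv s \<otimes> t \<in> H\<rbrakk> \<Longrightarrow> s = t"
  using left_transversal_R unfolding left_transversal_iff[OF H_subgroup] by blast

lemma induced_carrier_iff:
  "f \<in> carrier I \<longleftrightarrow> f \<in> extensional (carrier G) \<and> (\<forall>x\<in>carrier G. f x \<in> carrier E) \<and>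
     (\<forall>x\<in>carrier G. \<forall>h\<in>H. f (x \<otimes> h) = rep_act \<rho> (inv h) (f x)) \<and>
     (\<lambda>x. (hnorm E (f x))\<^sup>2) summable_on R"
  by (auto simp: induced_space_def PiE_iff)

lemma induced_val [simp, intro]: "\<lbrakk>f \<in> carrier I; x \<in> carrier G\<rbrakk> \<Longrightarrow> f x \<in> carrier E"
  and induced_ext: "f \<in> carrier I \<Longrightarrow> f \<in> extensional (carrier G)"
  and induced_mult: "\<lbrakk>f \<in> carrier I; x \<in> carrier G; h \<in> H\<rbrakk> \<Longrightarrow> f (x \<otimes> h) = rep_act \<rho> (inv h) (f x)"
  and induced_summable: "f \<in> carrier I \<Longrightarrow> (\<lambda>x. (hnorm E (f x))\<^sup>2) summable_on R"
  by (auto simp: induced_carrier_iff)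

lemma induced_eqI:
  "\<lbrakk>f \<in> carrier I; f' \<in> carrier I; \<And>x. x \<in> carrier G \<Longrightarrow> f x = f' x\<rbrakk> \<Longrightarrow> f = f'"
  by (rule extensionalityI[OF induced_ext induced_ext])

lemma induced_ops:
  "x \<in> carrier G \<Longrightarrow> \<zero>\<^bsub>I\<^esub> x = \<zero>\<^bsub>E\<^esub>"
  "x \<in> carrier G \<Longrightarrow> (f \<oplus>\<^bsub>I\<^esub> f') x = f x \<oplus>\<^bsub>E\<^esub> f' x"
  "x \<in> carrier G \<Longrightarrow> (c \<odot>\<^bsub>I\<^esub> f) x = c \<odot>\<^bsub>E\<^esub> f x"
  "\<zero>\<^bsub>I\<^esub> \<in> extensional (carrier G)"
  "f \<oplus>\<^bsub>I\<^esub> f' \<in> extensional (carrier G)"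
  "c \<odot>\<^bsub>I\<^esub> f \<in> extensional (carrier G)"
  by (simp_all add: induced_space_def)

lemma hinner_induced: "hinner I f f' = (\<Sum>\<^sub>\<infinity>x\<in>R. hinner E (f x) (f' x))"
  by (simp add: induced_space_def)

lemma induced_hnorm_mult:
  "\<lbrakk>f \<in> carrier I; x \<in> carrier G; h \<in> H\<rbrakk> \<Longrightarrow> hnorm E (f (x \<otimes> h)) = hnorm E (f x)"
  by (simp add: induced_mult act_hnorm)

lemma zero_induced: "\<zero>\<^bsub>I\<^esub> \<in> carrier I"
proof -
  have "(\<lambda>x. (hnorm E (\<zero>\<^bsub>I\<^esub> x))\<^sup>2) summable_on R \<longleftrightarrow> (\<lambda>x. 0 :: real) summable_on R"
    by (rule summable_on_cong) (simp add: induced_ops)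
  then show ?thesis
    by (simp add: induced_carrier_iff induced_ops act_zero)
qed

lemma add_induced:
  assumes f: "f \<in> carrier I" and f': "f' \<in> carrier I"
  shows "f \<oplus>\<^bsub>I\<^esub> f' \<in> carrier I"
proof -
  have "(\<lambda>x. 2 * (hnorm E (f x))\<^sup>2 + 2 * (hnorm E (f' x))\<^sup>2) summable_on R"
    using f f' by (intro summable_on_add summable_on_cmult_right induced_summable)
  then have "(\<lambda>x. (hnorm E ((f \<oplus>\<^bsub>I\<^esub> f') x))\<^sup>2) summable_on R"
    by (rule summable_on_comparison_test) (use f f' E.hnorm_power2_add_le in \<open>auto simp: induced_ops\<close>)
  then show ?thesis
    using f f' by (simp add: induced_carrier_iff induced_ops act_add)
qed

lemma smult_induced:
  assumes f: "f \<in> carrier I"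
  shows "c \<odot>\<^bsub>I\<^esub> f \<in> carrier I"
proof -
  have "(\<lambda>x. (cmod c)\<^sup>2 * (hnorm E (f x))\<^sup>2) summable_on R"
    using f by (intro summable_on_cmult_right induced_summable)
  moreover have "(\<lambda>x. (hnorm E ((c \<odot>\<^bsub>I\<^esub> f) x))\<^sup>2) summable_on R
      \<longleftrightarrow> (\<lambda>x. (cmod c)\<^sup>2 * (hnorm E (f x))\<^sup>2) summable_on R"
    by (rule summable_on_cong) (use f in \<open>simp add: induced_ops E.hnorm_power2_smult\<close>)
  ultimately show ?thesis
    using f by (simp add: induced_carrier_iff induced_ops act_smult)
qed

lemma hinner_induced_summable:
  assumes f: "f \<in> carrier I" and f': "f' \<in> carrier I"
  shows "(\<lambda>x. hinner E (f x) (f' x)) summable_on R"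
proof (rule abs_summable_summable, rule Infinite_Sum.abs_summable_on_comparison_test')
  show "(\<lambda>x. (hnorm E (f x))\<^sup>2 + (hnorm E (f' x))\<^sup>2) summable_on R"
    using f f' by (intro summable_on_add induced_summable)
  fix x assume x: "x \<in> R"
  have "cmod (hinner E (f x) (f' x)) \<le> hnorm E (f x) * hnorm E (f' x)"
    using f f' x by (intro E.cauchy_schwarz) auto
  also have "0 \<le> hnorm E (f x) * hnorm E (f' x)"
    using f f' x by simp
  then have "hnorm E (f x) * hnorm E (f' x) \<le> (hnorm E (f x))\<^sup>2 + (hnorm E (f' x))\<^sup>2"
    using sum_squares_bound[of "hnorm E (f x)" "hnorm E (f' x)"] by linarith
  finally show "norm (hinner E (f x) (f' x)) \<le> (hnorm E (f x))\<^sup>2 + (hnorm E (f' x))\<^sup>2"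
    by simp
qed

lemma Re_hinner_induced: "f \<in> carrier I \<Longrightarrow> Re (hinner I f f) = (\<Sum>\<^sub>\<infinity>x\<in>R. (hnorm E (f x))\<^sup>2)"
proof -
  assume f: "f \<in> carrier I"
  have "Re (hinner I f f) = (\<Sum>\<^sub>\<infinity>x\<in>R. Re (hinner E (f x) (f x)))"
    using infsum_Re[OF hinner_induced_summable[OF f f]] by (simp add: hinner_induced)
  also have "\<dots> = (\<Sum>\<^sub>\<infinity>x\<in>R. (hnorm E (f x))\<^sup>2)"
    by (rule infsum_cong) (use f in \<open>simp add: E.hnorm_power2\<close>)
  finally show ?thesis .
qed

lemma induced_abelian_group: "abelian_group I"
proof (rule abelian_groupI)
  show "\<zero>\<^bsub>I\<^esub> \<in> carrier I"
    by (rule zero_induced)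
  show "f \<oplus>\<^bsub>I\<^esub> f' \<in> carrier I" if "f \<in> carrier I" "f' \<in> carrier I" for f f'
    using that by (rule add_induced)
  show "(f \<oplus>\<^bsub>I\<^esub> f') \<oplus>\<^bsub>I\<^esub> f'' = f \<oplus>\<^bsub>I\<^esub> (f' \<oplus>\<^bsub>I\<^esub> f'')"
    if "f \<in> carrier I" "f' \<in> carrier I" "f'' \<in> carrier I" for f f' f''
    by (rule extensionalityI[of _ "carrier G"]) (use that in \<open>auto simp: induced_ops E.M.a_assoc\<close>)
  show "f \<oplus>\<^bsub>I\<^esub> f' = f' \<oplus>\<^bsub>I\<^esub> f" if "f \<in> carrier I" "f' \<in> carrier I" for f f'
    by (rule extensionalityI[of _ "carrier G"]) (use that in \<open>auto simp: induced_ops E.M.a_comm\<close>)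
  show "\<zero>\<^bsub>I\<^esub> \<oplus>\<^bsub>I\<^esub> f = f" if "f \<in> carrier I" for f
    by (rule extensionalityI[of _ "carrier G"]) (use that in \<open>auto simp: induced_ops induced_ext\<close>)
  show "\<exists>f'\<in>carrier I. f' \<oplus>\<^bsub>I\<^esub> f = \<zero>\<^bsub>I\<^esub>" if f: "f \<in> carrier I" for f
  proof (rule bexI[of _ "(- 1) \<odot>\<^bsub>I\<^esub> f"])
    show "(- 1) \<odot>\<^bsub>I\<^esub> f \<oplus>\<^bsub>I\<^esub> f = \<zero>\<^bsub>I\<^esub>"
      by (rule extensionalityI[of _ "carrier G"])
        (use f in \<open>auto simp: induced_ops E.smult_uminus_1 E.M.l_neg\<close>)
  qed (rule smult_induced[OF f])
qed

sublocale I: complex_inner_space I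
proof (intro complex_inner_space.intro complex_inner_space_axioms.intro moduleI)
  show "cring complex_ring"
    by (rule cring_from_type_algebra)
  show "abelian_group I"
    by (rule induced_abelian_group)
  show "c \<odot>\<^bsub>I\<^esub> f \<in> carrier I" if "f \<in> carrier I" for c f
    using that by (rule smult_induced)
  show "(c \<oplus>\<^bsub>complex_ring\<^esub> d) \<odot>\<^bsub>I\<^esub> f = c \<odot>\<^bsub>I\<^esub> f \<oplus>\<^bsub>I\<^esub> d \<odot>\<^bsub>I\<^esub> f" if "f \<in> carrier I" for c d f
    by (rule extensionalityI[of _ "carrier G"])
      (use that E.smult_l_distr[of c d] in \<open>auto simp: induced_ops\<close>)
  show "c \<odot>\<^bsub>I\<^esub> (f \<oplus>\<^bsub>I\<^esub> f') = c \<odot>\<^bsub>I\<^esub> f \<oplus>\<^bsub>I\<^esub> c \<odot>\<^bsub>I\<^esub> f'" if "f \<in> carrier I" "f' \<in> carrier I" for c f f'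
    by (rule extensionalityI[of _ "carrier G"])
      (use that E.smult_r_distr[of c] in \<open>auto simp: induced_ops\<close>)
  show "(c \<otimes>\<^bsub>complex_ring\<^esub> d) \<odot>\<^bsub>I\<^esub> f = c \<odot>\<^bsub>I\<^esub> (d \<odot>\<^bsub>I\<^esub> f)" if "f \<in> carrier I" for c d f
    by (rule extensionalityI[of _ "carrier G"])
      (use that E.smult_assoc1[of c d] in \<open>auto simp: induced_ops\<close>)
  show "\<one>\<^bsub>complex_ring\<^esub> \<odot>\<^bsub>I\<^esub> f = f" if "f \<in> carrier I" for f
    by (rule extensionalityI[of _ "carrier G"])
      (use that E.smult_one in \<open>auto simp: induced_ops induced_ext\<close>)
  show "hinner I (f \<oplus>\<^bsub>I\<^esub> f') f'' = hinner I f f'' + hinner I f' f''"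
    if "f \<in> carrier I" "f' \<in> carrier I" "f'' \<in> carrier I" for f f' f''
  proof -
    have "hinner I (f \<oplus>\<^bsub>I\<^esub> f') f'' = (\<Sum>\<^sub>\<infinity>x\<in>R. hinner E (f x) (f'' x) + hinner E (f' x) (f'' x))"
      unfolding hinner_induced by (rule infsum_cong) (use that in \<open>simp add: induced_ops E.hinner_add\<close>)
    then show ?thesis
      using that by (simp add: hinner_induced infsum_add hinner_induced_summable)
  qed
  show "hinner I (c \<odot>\<^bsub>I\<^esub> f) f' = c * hinner I f f'" if "f \<in> carrier I" "f' \<in> carrier I" for c f f'
  proof -
    have "hinner I (c \<odot>\<^bsub>I\<^esub> f) f' = (\<Sum>\<^sub>\<infinity>x\<in>R. c * hinner E (f x) (f' x))"
      unfolding hinner_induced by (rule infsum_cong) (use that in \<open>simp add: induced_ops E.hinner_smult\<close>)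
    then show ?thesis
      by (simp add: hinner_induced infsum_cmult_right')
  qed
  show "hinner I f' f = cnj (hinner I f f')" if "f \<in> carrier I" "f' \<in> carrier I" for f f'
    unfolding hinner_induced infsum_cnj[symmetric]
    by (rule infsum_cong) (use that in \<open>auto intro!: E.hinner_commute\<close>)
  show "0 \<le> Re (hinner I f f)" if "f \<in> carrier I" for f
    using that by (simp add: Re_hinner_induced infsum_nonneg)
  show "f = \<zero>\<^bsub>I\<^esub>" if f: "f \<in> carrier I" and 0: "hinner I f f = 0" for f
  proof (rule induced_eqI[OF f zero_induced])
    have "(\<Sum>\<^sub>\<infinity>x\<in>R. (hnorm E (f x))\<^sup>2) \<le> 0"
      using Re_hinner_induced[OF f] 0 by simp
    then have "(hnorm E (f t))\<^sup>2 = 0" if "t \<in> R" for t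
      using nonneg_infsum_le_0D[OF _ induced_summable[OF f] _ that] by simp
    then have *: "f t = \<zero>\<^bsub>E\<^esub>" if "t \<in> R" for t
      using that f by simp
    fix x assume x: "x \<in> carrier G"
    obtain t h where th: "t \<in> R" "h \<in> H" "x = t \<otimes> h"
      using R_cases[OF x] .
    then show "f x = \<zero>\<^bsub>I\<^esub> x"
      using * f x by (simp add: induced_mult induced_ops act_zero)
  qed
qed

lemma induced_minus:
  "\<lbrakk>f \<in> carrier I; f' \<in> carrier I; x \<in> carrier G\<rbrakk> \<Longrightarrow> (f \<ominus>\<^bsub>I\<^esub> f') x = f x \<ominus>\<^bsub>E\<^esub> f' x"
  by (simp add: I.minus_conv_smult E.minus_conv_smult induced_ops)

lemma hnorm_induced: "f \<in> carrier I \<Longrightarrow> (hnorm I f)\<^sup>2 = (\<Sum>\<^sub>\<infinity>x\<in>R. (hnorm E (f x))\<^sup>2)"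
  by (simp add: I.hnorm_power2 Re_hinner_induced)

lemma sum_hnorm_le:
  "\<lbrakk>f \<in> carrier I; finite F; F \<subseteq> R\<rbrakk> \<Longrightarrow> (\<Sum>x\<in>F. (hnorm E (f x))\<^sup>2) \<le> (hnorm I f)\<^sup>2"
  unfolding hnorm_induced by (rule finite_sum_le_infsum) (auto intro: induced_summable)

lemma hnorm_induced_leI:
  "\<lbrakk>f \<in> carrier I; \<And>F. \<lbrakk>finite F; F \<subseteq> R\<rbrakk> \<Longrightarrow> (\<Sum>x\<in>F. (hnorm E (f x))\<^sup>2) \<le> b\<rbrakk> \<Longrightarrow> (hnorm I f)\<^sup>2 \<le> b"
  unfolding hnorm_induced by (rule infsum_le_finite_sums) (auto intro: induced_summable)

lemma hnorm_val_le:
  assumes f: "f \<in> carrier I" and x: "x \<in> carrier G"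
  shows "(hnorm E (f x))\<^sup>2 \<le> (hnorm I f)\<^sup>2"
proof -
  obtain t h where th: "t \<in> R" "h \<in> H" "x = t \<otimes> h"
    using R_cases[OF x] .
  then show ?thesis
    using sum_hnorm_le[OF f, of "{t}"] f by (simp add: induced_hnorm_mult)
qed

text \<open>Only the representative of the coset \<open>c H\<close> contributes to the sum, and since \<open>H\<close> acts by
  unitary operators, it may be replaced by \<open>c\<close>.\<close>

lemma hinner_single_coset:
  assumes f: "f \<in> carrier I" and f': "f' \<in> carrier I" and c: "c \<in> carrier G"
    and supp: "\<And>x. x \<in> carrier G \<Longrightarrow> inv c \<otimes> x \<notin> H \<Longrightarrow> f x = \<zero>\<^bsub>E\<^esub>"
  shows "hinner I f f' = hinner E (f c) (f' c)"
proof -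
  obtain t h where th: "t \<in> R" "h \<in> H" "c = t \<otimes> h"
    using R_cases[OF c] .
  have "hinner I f f' = infsum (\<lambda>x. hinner E (f x) (f' x)) {t}"
    unfolding hinner_induced
  proof (rule infsum_cong_neutral)
    fix s assume s: "s \<in> R - {t}"
    have "inv c \<otimes> s \<notin> H"
    proof
      assume "inv c \<otimes> s \<in> H"
      then have "h \<otimes> (inv c \<otimes> s) \<in> H"
        using th(2) by simp
      moreover have "h \<otimes> (inv c \<otimes> s) = inv t \<otimes> s"
        using th s by (simp add: inv_mult_group m_assoc cancel_inv_left)
      ultimately show False
        using R_unique[of t s] th(1) s by auto
    qed
    then show "hinner E (f s) (f' s) = 0"
      using supp[of s] s f' by simp
  qed (use th in auto)
  also have "\<dots> = hinner E (f t) (f' t)"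
    by simp
  also have "\<dots> = hinner E (f c) (f' c)"
    using th f f' by (simp add: induced_mult act_hinner)
  finally show ?thesis .
qed

lemma tr_apply: "x \<in> carrier G \<Longrightarrow> tr g f x = f (inv g \<otimes> x)"
  by (simp add: Ind_def)

lemma tr_ext: "tr g f \<in> extensional (carrier G)"
  by (simp add: Ind_def)

lemma left_transversal_translate:
  assumes g: "g \<in> carrier G"
  shows "left_transversal G H ((\<lambda>x. g \<otimes> x) ` R)"
  unfolding left_transversal_iff[OF H_subgroup]
proof (intro conjI ballI impI)
  show "(\<lambda>x. g \<otimes> x) ` R \<subseteq> carrier G"
    using g by auto
  show "\<exists>t\<in>(\<lambda>x. g \<otimes> x) ` R. \<exists>h\<in>H. x = t \<otimes> h" if x: "x \<in> carrier G" for x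
  proof -
    obtain t h where th: "t \<in> R" "h \<in> H" "inv g \<otimes> x = t \<otimes> h"
      using R_cases[of "inv g \<otimes> x"] g x by auto
    then have "x = g \<otimes> t \<otimes> h"
      using g x by (metis H_carrier R_carrier cancel_inv_left(2) m_assoc)
    then show ?thesis
      using th by blast
  qed
  show "s = t" if s: "s \<in> (\<lambda>x. g \<otimes> x) ` R" and t: "t \<in> (\<lambda>x. g \<otimes> x) ` R" and "inv s \<otimes> t \<in> H" for s t
  proof -
    obtain s' t' where st: "s = g \<otimes> s'" "t = g \<otimes> t'" "s' \<in> R" "t' \<in> R"
      using s t by blast
    then have "inv s' \<otimes> t' \<in> H"
      using \<open>inv s \<otimes> t \<in> H\<close> g by (simp add: inv_mult_group m_assoc cancel_inv_left)
    then show ?thesis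
      using st R_unique by blast
  qed
qed

lemma tr_closed [simp, intro]:
  assumes g: "g \<in> carrier G" and f: "f \<in> carrier I"
  shows "tr g f \<in> carrier I"
proof -
  let ?F = "\<lambda>x. (hnorm E (f x))\<^sup>2"
  let ?Q = "(\<lambda>x. inv g \<otimes> x) ` R"
  have "?F summable_on ?Q"
    using summable_on_left_transversal_cong[OF H_subgroup left_transversal_R
        left_transversal_translate[OF inv_closed[OF g]], of ?F] f
    by (simp add: induced_hnorm_mult induced_summable)
  moreover have "inj_on (\<lambda>x. inv g \<otimes> x) R"
    using g by (auto intro!: inj_onI)
  ultimately have "(?F \<circ> (\<lambda>x. inv g \<otimes> x)) summable_on R"
    by (simp add: summable_on_reindex)
  moreover have "(\<lambda>x. (hnorm E (tr g f x))\<^sup>2) summable_on R \<longleftrightarrow> (?F \<circ> (\<lambda>x. inv g \<otimes> x)) summable_on R"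
    by (rule summable_on_cong) (simp add: tr_apply)
  ultimately show ?thesis
    using f g by (simp add: induced_carrier_iff tr_ext tr_apply m_assoc[symmetric])
qed

lemma tr_hinner:
  assumes g: "g \<in> carrier G" and f: "f \<in> carrier I" and f': "f' \<in> carrier I"
  shows "hinner I (tr g f) (tr g f') = hinner I f f'"
proof -
  let ?F = "\<lambda>x. hinner E (f x) (f' x)"
  let ?Q = "(\<lambda>x. inv g \<otimes> x) ` R"
  have "hinner I (tr g f) (tr g f') = infsum (?F \<circ> (\<lambda>x. inv g \<otimes> x)) R"
    unfolding hinner_induced by (rule infsum_cong) (simp add: tr_apply)
  also have "\<dots> = infsum ?F ?Q"
    by (rule infsum_reindex[symmetric]) (use g in \<open>auto intro!: inj_onI\<close>)
  also have "\<dots> = infsum ?F R"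
    using infsum_left_transversal_cong[OF H_subgroup left_transversal_R
        left_transversal_translate[OF inv_closed[OF g]], of ?F] f f'
    by (simp add: induced_mult act_hinner)
  finally show ?thesis
    by (simp add: hinner_induced)
qed

lemma tr_hnorm: "\<lbrakk>g \<in> carrier G; f \<in> carrier I\<rbrakk> \<Longrightarrow> hnorm I (tr g f) = hnorm I f"
  by (simp add: hnorm_def tr_hinner)

text \<open>The copy of \<open>\<rho>\<close> inside the induced representation: functions supported on the coset \<open>H\<close>,
  parametrized by their value at \<open>\<one>\<close>.\<close>

definition single :: "'h \<Rightarrow> 'g \<Rightarrow> 'h" where
  "single v = (\<lambda>x\<in>carrier G. if x \<in> H then rep_act \<rho> (inv x) v else \<zero>\<^bsub>E\<^esub>)"

lemma single_apply: "x \<in> H \<Longrightarrow> single v x = rep_act \<rho> (inv x) v"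
  "\<lbrakk>x \<in> carrier G; x \<notin> H\<rbrakk> \<Longrightarrow> single v x = \<zero>\<^bsub>E\<^esub>"
  by (simp_all add: single_def)

lemma single_one [simp]: "v \<in> carrier E \<Longrightarrow> single v \<one> = v"
  by (simp add: single_apply)

lemma mult_mem_H_iff: "\<lbrakk>x \<in> carrier G; h \<in> H\<rbrakk> \<Longrightarrow> x \<otimes> h \<in> H \<longleftrightarrow> x \<in> H"
  by (metis H.m_closed H.m_inv_closed H_carrier inv_closed m_assoc r_inv r_one)

lemma single_closed [simp, intro]:
  assumes v: "v \<in> carrier E"
  shows "single v \<in> carrier I"
proof -
  have "{x \<in> R. (hnorm E (single v x))\<^sup>2 \<noteq> 0} \<subseteq> {x \<in> R. x \<in> H}"
    using v by (auto simp: single_def split: if_splits)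
  moreover have "s = t" if "s \<in> R" "s \<in> H" "t \<in> R" "t \<in> H" for s t
    using R_unique[OF that(1,3)] that by simp
  then have "finite {x \<in> R. x \<in> H}"
    by (cases "{x \<in> R. x \<in> H} = {}") (auto intro!: finite_subset[of "{x \<in> R. x \<in> H}" "{SOME x. x \<in> R \<and> x \<in> H}"] intro: someI2)
  ultimately have "(\<lambda>x. (hnorm E (single v x))\<^sup>2) summable_on R"
    by (intro finite_nonzero_values_imp_summable_on) (rule finite_subset)
  moreover have "single v (x \<otimes> h) = rep_act \<rho> (inv h) (single v x)" if "x \<in> carrier G" "h \<in> H" for x h
    using that v by (cases "x \<in> H")
      (simp_all add: single_apply inv_mult_group act_mult mult_mem_H_iff act_zero)
  moreover have "single v x \<in> carrier E" if "x \<in> carrier G" for x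
    using that v by (simp add: single_def)
  ultimately show ?thesis
    by (simp add: induced_carrier_iff) (simp add: single_def)
qed

lemma single_eqI:
  assumes f: "f \<in> carrier I" and supp: "\<And>x. \<lbrakk>x \<in> carrier G; x \<notin> H\<rbrakk> \<Longrightarrow> f x = \<zero>\<^bsub>E\<^esub>"
  shows "f = single (f \<one>)"
proof (rule induced_eqI[OF f])
  show "single (f \<one>) \<in> carrier I"
    using f by simp
  fix x assume x: "x \<in> carrier G"
  show "f x = single (f \<one>) x"
    using supp[OF x] x induced_mult[OF f one_closed, of x] by (cases "x \<in> H") (simp_all add: single_apply)
qed

lemma single_add: "\<lbrakk>v \<in> carrier E; w \<in> carrier E\<rbrakk> \<Longrightarrow> single (v \<oplus>\<^bsub>E\<^esub> w) = single v \<oplus>\<^bsub>I\<^esub> single w"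
proof (rule induced_eqI)
  assume vw: "v \<in> carrier E" "w \<in> carrier E"
  fix x assume x: "x \<in> carrier G"
  show "single (v \<oplus>\<^bsub>E\<^esub> w) x = (single v \<oplus>\<^bsub>I\<^esub> single w) x"
    using vw x by (cases "x \<in> H") (simp_all add: single_apply induced_ops act_add)
qed auto

lemma single_smult: "v \<in> carrier E \<Longrightarrow> single (c \<odot>\<^bsub>E\<^esub> v) = c \<odot>\<^bsub>I\<^esub> single v"
proof (rule induced_eqI)
  assume v: "v \<in> carrier E"
  fix x assume x: "x \<in> carrier G"
  show "single (c \<odot>\<^bsub>E\<^esub> v) x = (c \<odot>\<^bsub>I\<^esub> single v) x"
    using v x E.smult_r_null[of c] by (cases "x \<in> H") (simp_all add: single_apply induced_ops act_smult)
qed auto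

lemma hinner_single: "\<lbrakk>v \<in> carrier E; f \<in> carrier I\<rbrakk> \<Longrightarrow> hinner I (single v) f = hinner E v (f \<one>)"
  by (subst hinner_single_coset[of _ _ \<one>]) (auto simp: single_apply)

lemma single_minus: "\<lbrakk>v \<in> carrier E; w \<in> carrier E\<rbrakk> \<Longrightarrow> single (v \<ominus>\<^bsub>E\<^esub> w) = single v \<ominus>\<^bsub>I\<^esub> single w"
  by (simp add: E.minus_conv_smult I.minus_conv_smult single_add single_smult)

lemma hnorm_single: "v \<in> carrier E \<Longrightarrow> hnorm I (single v) = hnorm E v"
  by (simp add: hnorm_def hinner_single)

lemma tr_single:
  assumes h: "h \<in> H" and v: "v \<in> carrier E"
  shows "tr h (single v) = single (rep_act \<rho> h v)"
proof (rule induced_eqI)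
  fix x assume x: "x \<in> carrier G"
  have "inv h \<otimes> x \<in> H \<longleftrightarrow> x \<in> H"
    using h x by (metis H.m_closed H.m_inv_closed H_carrier cancel_inv_left(2))
  then show "tr h (single v) x = single (rep_act \<rho> h v) x"
    using x h v by (cases "x \<in> H") (simp_all add: tr_apply single_apply inv_mult_group act_mult)
qed (use h v in auto)

text \<open>The function \<open>x \<mapsto> \<parallel>f(x)\<parallel>\<close> is constant on cosets of \<open>H\<close> and square summable over them, so it
  cannot stay away from \<open>0\<close> on infinitely many cosets.\<close>

lemma orbit_small_value:
  assumes A: "subgroup A G" and g: "g \<in> carrier G" and inf: "infinite (coset_orbit A g H)"
    and f: "f \<in> carrier I" and e: "e > 0"
  shows "\<exists>a\<in>A. (hnorm E (f (a \<otimes> g)))\<^sup>2 < e"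
proof (rule ccontr)
  assume "\<not> ?thesis"
  then have ge: "e \<le> (hnorm E (f (a \<otimes> g)))\<^sup>2" if "a \<in> A" for a
    using that by force
  define D where "D = {t \<in> R. e \<le> (hnorm E (f t))\<^sup>2}"
  have "coset_orbit A g H \<subseteq> (\<lambda>t. t <# H) ` D"
  proof
    fix Y assume "Y \<in> coset_orbit A g H"
    then obtain a where a: "a \<in> A" "Y = a \<otimes> g <# H"
      by (auto simp: coset_orbit_def)
    have ag: "a \<otimes> g \<in> carrier G"
      using subgroup.mem_carrier[OF A a(1)] g by simp
    obtain t h where th: "t \<in> R" "h \<in> H" "a \<otimes> g = t \<otimes> h"
      using R_cases[OF ag] .
    have "t \<in> D"
      using th ge[OF a(1)] f by (simp add: D_def induced_hnorm_mult)
    moreover have "inv t \<otimes> (a \<otimes> g) \<in> H"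
      using th by (simp add: cancel_inv_left)
    then have "Y = t <# H"
      using a(2) l_coset_eq_iff[OF H_subgroup _ ag, of t] th(1) by simp
    ultimately show "Y \<in> (\<lambda>t. t <# H) ` D"
      by blast
  qed
  then have "infinite D"
    using inf finite_surj by blast
  obtain n :: nat where n: "(hnorm I f)\<^sup>2 < real n * e"
    using reals_Archimedean3[OF e] by blast
  obtain F where F: "F \<subseteq> D" "finite F" "card F = n"
    using infinite_arbitrarily_large[OF \<open>infinite D\<close>] by blast
  have "real n * e \<le> (\<Sum>t\<in>F. (hnorm E (f t))\<^sup>2)"
    using F sum_bounded_below[of F e "\<lambda>t. (hnorm E (f t))\<^sup>2"] by (auto simp: D_def)
  also have "\<dots> \<le> (hnorm I f)\<^sup>2"
    using F by (intro sum_hnorm_le[OF f]) (auto simp: D_def)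
  finally show False
    using n by simp
qed

text \<open>A function fixed by \<open>A\<close> has constant norm along each \<open>A\<close>-orbit of cosets.\<close>

lemma fixed_imp_finite_orbit:
  assumes A: "subgroup A G" and f: "f \<in> carrier I" and fixed: "\<And>a. a \<in> A \<Longrightarrow> tr a f = f"
    and g: "g \<in> carrier G" and nz: "f g \<noteq> \<zero>\<^bsub>E\<^esub>"
  shows "finite (coset_orbit A g H)"
proof (rule ccontr)
  assume inf: "infinite (coset_orbit A g H)"
  have "(hnorm E (f g))\<^sup>2 > 0"
    using f g nz by simp
  then obtain a where a: "a \<in> A" "(hnorm E (f (a \<otimes> g)))\<^sup>2 < (hnorm E (f g))\<^sup>2"
    using orbit_small_value[OF A g inf f] by blast
  have "tr (inv a) f g = f (a \<otimes> g)"
    using g subgroup.mem_carrier[OF A a(1)] by (simp add: tr_apply)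
  then show False
    using a(2) fixed[OF subgroup.m_inv_closed[OF A a(1)]] by simp
qed

end

section \<open>Irreducibility of induced representations\<close>

context subgroup_rep
begin

lemma single_fixed:
  assumes v: "v \<in> H" "\<And>w. w \<in> carrier E \<Longrightarrow> rep_act \<rho> v w = w" and w: "w \<in> carrier E"
  shows "tr v (single w) = single w"
  using v w by (simp add: tr_single)

text \<open>Consider the convex set \<open>C\<close> of all \<open>a \<in> W\<close> with \<open>a(\<one>) = f(\<one>)\<close>, and let \<open>d\<close> be the infimum of
  \<open>\<parallel>a\<parallel>\<^sup>2\<close> on it. Since \<open>V\<close> acts trivially through \<open>\<rho>\<close>, the set \<open>C\<close> is stable under \<open>V\<close>. By the
  parallelogram law two elements of \<open>C\<close> of almost minimal norm are close to each other; applied to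
  \<open>a\<close> and a \<open>V\<close>-translate of \<open>a\<close>, this says that \<open>a\<close> is almost fixed by \<open>V\<close>. As the
  \<open>V\<close>-orbits of cosets other than \<open>H\<close> are infinite, such an \<open>a\<close> is pointwise small off \<open>H\<close>; and as
  almost minimizers are close in norm, pointwise smallness improves to smallness in norm.
  On \<open>H\<close>, all elements of \<open>C\<close> agree with \<open>single (f \<one>)\<close>. Hence almost minimizers converge to it.\<close>

lemma single_in_closed_invariant:
  assumes W: "submodule W complex_ring I" "closedin (hilbert_topology I) W"
    and inv: "\<And>g f. \<lbrakk>g \<in> carrier G; f \<in> W\<rbrakk> \<Longrightarrow> tr g f \<in> W"
    and V: "subgroup V G" "V \<subseteq> H" "\<And>v w. \<lbrakk>v \<in> V; w \<in> carrier E\<rbrakk> \<Longrightarrow> rep_act \<rho> v w = w"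
    and orbits: "\<And>g. \<lbrakk>g \<in> carrier G; g \<notin> H\<rbrakk> \<Longrightarrow> infinite (coset_orbit V g H)"
    and f: "f \<in> W"
  shows "single (f \<one>) \<in> W"
proof -
  have WI: "W \<subseteq> carrier I"
    using I.submoduleE(1)[OF W(1)] .
  have Wadd: "a \<oplus>\<^bsub>I\<^esub> b \<in> W" if "a \<in> W" "b \<in> W" for a b
    using I.submoduleE(5)[OF W(1)] that .
  have Wsm: "c \<odot>\<^bsub>I\<^esub> a \<in> W" if "a \<in> W" for c a
    using I.submoduleE(4)[OF W(1)] that by simp
  define C where "C = {a \<in> W. a \<one> = f \<one>}"
  have CI: "a \<in> carrier I" if "a \<in> C" for a
    using that WI by (auto simp: C_def)
  have fC: "f \<in> C"
    using f by (simp add: C_def)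
  define d where "d = Inf ((\<lambda>a. (hnorm I a)\<^sup>2) ` C)"
  have bdd: "bdd_below ((\<lambda>a. (hnorm I a)\<^sup>2) ` C)"
    by (rule bdd_belowI[of _ 0]) auto
  have d_le: "d \<le> (hnorm I a)\<^sup>2" if "a \<in> C" for a
    unfolding d_def by (rule cInf_lower[OF _ bdd]) (use that in auto)
  have d_ex: "\<exists>a\<in>C. (hnorm I a)\<^sup>2 < d + e" if "e > 0" for e
    using cInf_lessD[of "(\<lambda>a. (hnorm I a)\<^sup>2) ` C" "d + e"] fC that unfolding d_def[symmetric] by auto
  \<comment> \<open>Almost minimizers are close, because their midpoint lies in \<open>C\<close> again.\<close>
  have close: "(hnorm I (a \<ominus>\<^bsub>I\<^esub> b))\<^sup>2 \<le> 2 * e + 2 * e'"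
    if a: "a \<in> C" "(hnorm I a)\<^sup>2 \<le> d + e" and b: "b \<in> C" "(hnorm I b)\<^sup>2 \<le> d + e'" for a b e e'
  proof -
    let ?m = "(1/2) \<odot>\<^bsub>I\<^esub> (a \<oplus>\<^bsub>I\<^esub> b)"
    have "(1/2) \<odot>\<^bsub>E\<^esub> (f \<one> \<oplus>\<^bsub>E\<^esub> f \<one>) = f \<one>"
    proof -
      have f1: "f \<one> \<in> carrier E"
        using CI[OF fC] by simp
      have "(1/2) \<odot>\<^bsub>E\<^esub> (f \<one> \<oplus>\<^bsub>E\<^esub> f \<one>) = (1/2 \<oplus>\<^bsub>complex_ring\<^esub> 1/2) \<odot>\<^bsub>E\<^esub> f \<one>"
        using f1 E.smult_l_distr[of "1/2" "1/2" "f \<one>"] E.smult_r_distr[of "1/2" "f \<one>" "f \<one>"] by simp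
      then show ?thesis
        using f1 E.smult_one[of "f \<one>"] by simp
    qed
    then have "?m \<in> C"
      using a b Wadd Wsm by (simp add: C_def induced_ops)
    then have "d \<le> (hnorm I ?m)\<^sup>2"
      by (rule d_le)
    also have "\<dots> = (hnorm I (a \<oplus>\<^bsub>I\<^esub> b))\<^sup>2 / 4"
      using CI[OF a(1)] CI[OF b(1)] I.hnorm_power2_smult[of "a \<oplus>\<^bsub>I\<^esub> b" "1/2"]
      by (simp add: norm_divide power_divide)
    finally show ?thesis
      using I.parallelogram[OF CI[OF a(1)] CI[OF b(1)]] a(2) b(2) by linarith
  qed
  \<comment> \<open>Compare \<open>b\<close> with a \<open>V\<close>-translate that is small at \<open>g\<close>.\<close>
  have small: "(hnorm E (b g))\<^sup>2 \<le> 10 * e"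
    if b: "b \<in> C" "(hnorm I b)\<^sup>2 \<le> d + e" and e: "e > 0" and g: "g \<in> carrier G" "g \<notin> H" for b e g
  proof -
    note bI = CI[OF b(1)]
    obtain v where v: "v \<in> V" "(hnorm E (b (v \<otimes> g)))\<^sup>2 < e"
      using orbit_small_value[OF V(1) g(1) orbits[OF g] bI e] by blast
    have vc: "v \<in> carrier G" "v \<in> H"
      using v(1) V(2) by auto
    let ?c = "tr (inv v) b"
    have "?c \<one> = b (\<one> \<otimes> v)"
      using vc by (simp add: tr_apply)
    also have "\<dots> = b \<one>"
      using induced_mult[OF bI one_closed vc(2)] V(3)[OF subgroup.m_inv_closed[OF V(1) v(1)]] bI by simp
    finally have "?c \<in> C"
      using b(1) inv[of "inv v" b] vc by (simp add: C_def)
    then have "(hnorm I (b \<ominus>\<^bsub>I\<^esub> ?c))\<^sup>2 \<le> 4 * e"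
      using close[OF b, of ?c e] b(2) tr_hnorm[of "inv v" b] bI vc by simp
    moreover have "(hnorm E ((b \<ominus>\<^bsub>I\<^esub> ?c) g))\<^sup>2 \<le> (hnorm I (b \<ominus>\<^bsub>I\<^esub> ?c))\<^sup>2"
      by (rule hnorm_val_le) (use bI vc g in auto)
    moreover have "(b \<ominus>\<^bsub>I\<^esub> ?c) g = b g \<ominus>\<^bsub>E\<^esub> b (v \<otimes> g)"
      using bI vc g by (simp add: induced_minus tr_apply)
    moreover have "(hnorm E (b g))\<^sup>2 \<le> 2 * (hnorm E (b g \<ominus>\<^bsub>E\<^esub> b (v \<otimes> g)))\<^sup>2 + 2 * (hnorm E (b (v \<otimes> g)))\<^sup>2"
      using bI vc g by (intro E.hnorm_power2_le_minus) auto
    ultimately show ?thesis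
      using v(2) by simp
  qed
  have near: "(hnorm I (single (f \<one>) \<ominus>\<^bsub>I\<^esub> a))\<^sup>2 \<le> 9 * e"
    if a: "a \<in> C" "(hnorm I a)\<^sup>2 \<le> d + e" and e: "e > 0" for a e
  proof (rule hnorm_induced_leI)
    note aI = CI[OF a(1)]
    have f1: "f \<one> \<in> carrier E"
      using CI[OF fC] by simp
    show "single (f \<one>) \<ominus>\<^bsub>I\<^esub> a \<in> carrier I"
      using aI f1 by auto
    fix F assume F: "finite F" "F \<subseteq> R"
    let ?k = "real (card F)"
    \<comment> \<open>The finitely many values on \<open>F\<close> are controlled by a better minimizer \<open>b\<close>, with an error \<open>e'\<close>
      chosen so that the pointwise bounds \<open>20 e'\<close> sum to at most \<open>e\<close>.\<close>
    define e' where "e' = e / (20 * ?k + 1)"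
    have e': "e' > 0" "e' \<le> e" "20 * ?k * e' \<le> e"
      using e by (simp_all add: e'_def divide_simps)
    obtain b where b: "b \<in> C" "(hnorm I b)\<^sup>2 < d + e'"
      using d_ex[OF e'(1)] by blast
    note bI = CI[OF b(1)]
    have "(\<Sum>x\<in>F. (hnorm E ((single (f \<one>) \<ominus>\<^bsub>I\<^esub> a) x))\<^sup>2)
        \<le> (\<Sum>x\<in>F. 2 * (hnorm E ((a \<ominus>\<^bsub>I\<^esub> b) x))\<^sup>2 + 20 * e')"
    proof (rule sum_mono)
      fix x assume "x \<in> F"
      then have x: "x \<in> carrier G"
        using F by auto
      show "(hnorm E ((single (f \<one>) \<ominus>\<^bsub>I\<^esub> a) x))\<^sup>2 \<le> 2 * (hnorm E ((a \<ominus>\<^bsub>I\<^esub> b) x))\<^sup>2 + 20 * e'"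
      proof (cases "x \<in> H")
        case True
        have "a x = single (f \<one>) x"
          using induced_mult[OF aI one_closed True] a(1) True by (simp add: C_def single_apply)
        then have "(single (f \<one>) \<ominus>\<^bsub>I\<^esub> a) x = \<zero>\<^bsub>E\<^esub>"
          using aI f1 x by (simp add: induced_minus E.minus_eq_zero_iff)
        then show ?thesis
          using e' by simp
      next
        case False
        have "(single (f \<one>) \<ominus>\<^bsub>I\<^esub> a) x = (- 1) \<odot>\<^bsub>E\<^esub> a x"
          using aI f1 x False by (simp add: induced_minus E.minus_conv_smult single_apply)
        then have "(hnorm E ((single (f \<one>) \<ominus>\<^bsub>I\<^esub> a) x))\<^sup>2 = (hnorm E (a x))\<^sup>2"
          using aI x by (simp add: E.hnorm_power2_smult)
        also have "\<dots> \<le> 2 * (hnorm E (a x \<ominus>\<^bsub>E\<^esub> b x))\<^sup>2 + 2 * (hnorm E (b x))\<^sup>2"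
          using aI bI x by (intro E.hnorm_power2_le_minus) auto
        finally show ?thesis
          using small[OF b(1) less_imp_le[OF b(2)] e'(1) x False] aI bI x by (simp add: induced_minus)
      qed
    qed
    also have "\<dots> = 2 * (\<Sum>x\<in>F. (hnorm E ((a \<ominus>\<^bsub>I\<^esub> b) x))\<^sup>2) + 20 * ?k * e'"
      by (simp add: sum.distrib sum_distrib_left)
    also have "\<dots> \<le> 2 * (hnorm I (a \<ominus>\<^bsub>I\<^esub> b))\<^sup>2 + e"
      using sum_hnorm_le[of "a \<ominus>\<^bsub>I\<^esub> b" F] aI bI F e'(3) by simp
    also have "\<dots> \<le> 9 * e"
      using close[OF a b(1) less_imp_le[OF b(2)]] e'(2) by simp
    finally show "(\<Sum>x\<in>F. (hnorm E ((single (f \<one>) \<ominus>\<^bsub>I\<^esub> a) x))\<^sup>2) \<le> 9 * e" .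
  qed
  have "\<exists>w\<in>W. (hnorm I (single (f \<one>) \<ominus>\<^bsub>I\<^esub> w))\<^sup>2 < e" if e: "e > 0" for e
  proof -
    obtain a where a: "a \<in> C" "(hnorm I a)\<^sup>2 < d + e / 10"
      using d_ex[of "e / 10"] e by auto
    have "(hnorm I (single (f \<one>) \<ominus>\<^bsub>I\<^esub> a))\<^sup>2 < e"
      using near[OF a(1) less_imp_le[OF a(2)]] e by simp
    then show ?thesis
      using a(1) by (auto simp: C_def)
  qed
  moreover have "single (f \<one>) \<in> carrier I"
    using CI[OF fC] by simp
  ultimately show ?thesis
    using W(2) unfolding I.closedin_iff_approximable by blast
qed

text \<open>The translates of the functions supported on \<open>H\<close> span all functions supported on finitely many
  cosets, and these are dense.\<close>

lemma closed_invariant_eq_carrier: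
  assumes W: "submodule W complex_ring I" "closedin (hilbert_topology I) W"
    and inv: "\<And>g f. \<lbrakk>g \<in> carrier G; f \<in> W\<rbrakk> \<Longrightarrow> tr g f \<in> W"
    and single: "\<And>v. v \<in> carrier E \<Longrightarrow> single v \<in> W"
  shows "W = carrier I"
proof
  show WI: "W \<subseteq> carrier I"
    using I.submoduleE(1)[OF W(1)] .
  show "carrier I \<subseteq> W"
  proof
    fix f assume f: "f \<in> carrier I"
    \<comment> \<open>The restriction of \<open>f\<close> to the cosets of \<open>t \<in> F\<close> is the sum of the translates of \<open>single (f t)\<close>.\<close>
    have trunc: "\<exists>w\<in>W. (\<forall>x\<in>F. w x = f x) \<and> (\<forall>x\<in>R - F. w x = \<zero>\<^bsub>E\<^esub>)"
      if "finite F" "F \<subseteq> R" for F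
      using that
    proof (induction F rule: finite_induct)
      case empty
      have "\<zero>\<^bsub>I\<^esub> \<in> W"
        using W(1) subgroup.one_closed[of W "add_monoid I"] by (auto simp: submodule_def)
      then show ?case
        by (auto intro!: bexI[of _ "\<zero>\<^bsub>I\<^esub>"] simp: induced_ops)
    next
      case (insert t F)
      then obtain w where w: "w \<in> W" "\<And>x. x \<in> F \<Longrightarrow> w x = f x" "\<And>x. x \<in> R - F \<Longrightarrow> w x = \<zero>\<^bsub>E\<^esub>"
        by auto
      have t: "t \<in> R" "t \<in> carrier G" "t \<notin> F" and FR: "F \<subseteq> R"
        using insert by auto
      let ?s = "tr t (single (f t))"
      have s1: "?s t = f t"
        using t f by (simp add: tr_apply)
      have s2: "?s x = \<zero>\<^bsub>E\<^esub>" if x: "x \<in> R" "x \<noteq> t" for x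
      proof -
        have "inv t \<otimes> x \<notin> H"
          using R_unique[OF t(1) x(1)] x(2) by blast
        then show ?thesis
          using t x by (simp add: tr_apply single_apply)
      qed
      have "w \<oplus>\<^bsub>I\<^esub> ?s \<in> W"
        using I.submoduleE(5)[OF W(1) w(1)] inv[OF t(2)] single f t by auto
      moreover have "(w \<oplus>\<^bsub>I\<^esub> ?s) x = f x" if x: "x \<in> insert t F" for x
      proof (cases "x = t")
        case True
        then show ?thesis
          using s1 w(3)[of t] t f by (simp add: induced_ops)
      next
        case False
        then have "x \<in> F" "x \<in> R"
          using x FR by auto
        then show ?thesis
          using s2[OF _ False] w(2) f by (simp add: induced_ops)
      qed
      moreover have "(w \<oplus>\<^bsub>I\<^esub> ?s) x = \<zero>\<^bsub>E\<^esub>" if "x \<in> R - insert t F" for x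
        using s2[of x] w(3)[of x] that by (simp add: induced_ops)
      ultimately show ?case
        by blast
    qed
    have "\<exists>w\<in>W. (hnorm I (f \<ominus>\<^bsub>I\<^esub> w))\<^sup>2 < e" if e: "e > 0" for e
    proof -
      let ?n = "\<lambda>x. (hnorm E (f x))\<^sup>2"
      obtain F where F: "finite F" "F \<subseteq> R" "dist (sum ?n F) (infsum ?n R) \<le> e / 2"
        using infsum_finite_approximation[OF induced_summable[OF f], of "e / 2"] e by auto
      obtain w where w: "w \<in> W" "\<And>x. x \<in> F \<Longrightarrow> w x = f x" "\<And>x. x \<in> R - F \<Longrightarrow> w x = \<zero>\<^bsub>E\<^esub>"
        using trunc[OF F(1,2)] by auto
      have wI: "w \<in> carrier I"
        using w(1) WI by auto
      have "(hnorm I (f \<ominus>\<^bsub>I\<^esub> w))\<^sup>2 \<le> e / 2"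
      proof (rule hnorm_induced_leI)
        show "f \<ominus>\<^bsub>I\<^esub> w \<in> carrier I"
          using f wI by auto
        fix D assume D: "finite D" "D \<subseteq> R"
        have "(\<Sum>x\<in>D. (hnorm E ((f \<ominus>\<^bsub>I\<^esub> w) x))\<^sup>2) = (\<Sum>x\<in>D - F. ?n x)"
        proof (rule sum.mono_neutral_cong_right)
          show "\<forall>x\<in>D - (D - F). (hnorm E ((f \<ominus>\<^bsub>I\<^esub> w) x))\<^sup>2 = 0"
            using D F w(2) f wI by (auto simp: induced_minus E.minus_eq_zero_iff)
          show "(hnorm E ((f \<ominus>\<^bsub>I\<^esub> w) x))\<^sup>2 = ?n x" if "x \<in> D - F" for x
          proof -
            have "x \<in> R - F"
              using that D by auto
            then show ?thesis
              using w(3)[of x] f wI E.smult_r_null[of "- 1"] by (simp add: induced_minus E.minus_conv_smult)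
          qed
        qed (use D in auto)
        also have "\<dots> = sum ?n (D \<union> F) - sum ?n F"
          using sum_diff[of "D \<union> F" F ?n] D F by (simp add: Un_Diff)
        also have "\<dots> \<le> infsum ?n R - sum ?n F"
          using sum_hnorm_le[OF f, of "D \<union> F"] D F f by (simp add: hnorm_induced)
        also have "\<dots> \<le> e / 2"
          using F(3) unfolding dist_real_def by linarith
        finally show "(\<Sum>x\<in>D. (hnorm E ((f \<ominus>\<^bsub>I\<^esub> w) x))\<^sup>2) \<le> e / 2" .
      qed
      then show ?thesis
        using w(1) e by force
    qed
    then show "f \<in> W"
      using W(2) f unfolding I.closedin_iff_approximable by blast
  qed
qed

text \<open>A closed invariant subspace \<open>W\<^sub>0\<close> for \<open>\<rho>\<close> gives the closed invariant subspace of the induced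
  representation that consists of the functions with values in \<open>W\<^sub>0\<close>. Evaluating functions of the form
  \<open>single v\<close> at \<open>\<one>\<close> recovers \<open>W\<^sub>0\<close> from it.\<close>

lemma irreducible_Ind_imp_irreducible:
  assumes irr: "irreducible_rep G (Ind G H \<rho>)"
  shows "irreducible_rep (G\<lparr>carrier := H\<rparr>) \<rho>"
  unfolding irreducible_rep_def
proof (intro conjI allI impI)
  have space: "rep_space (Ind G H \<rho>) = I"
    by (simp add: Ind_def)
  have nz: "carrier I \<noteq> {\<zero>\<^bsub>I\<^esub>}"
    and irrI: "\<And>W. \<lbrakk>submodule W complex_ring I; closedin (hilbert_topology I) W;
      \<And>g. g \<in> carrier G \<Longrightarrow> tr g ` W \<subseteq> W\<rbrakk> \<Longrightarrow> W = {\<zero>\<^bsub>I\<^esub>} \<or> W = carrier I"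
    using irr unfolding irreducible_rep_def space by blast+
  show "carrier E \<noteq> {\<zero>\<^bsub>E\<^esub>}"
  proof
    assume E0: "carrier E = {\<zero>\<^bsub>E\<^esub>}"
    have "f = \<zero>\<^bsub>I\<^esub>" if "f \<in> carrier I" for f
      by (rule induced_eqI) (use that induced_val[OF that] E0 in \<open>auto simp: induced_ops\<close>)
    then show False
      using nz I.M.zero_closed by blast
  qed
  fix W0 assume "submodule W0 complex_ring E \<and> closedin (hilbert_topology E) W0 \<and>
    (\<forall>h\<in>carrier (G\<lparr>carrier := H\<rparr>). rep_act \<rho> h ` W0 \<subseteq> W0)"
  then have W0: "submodule W0 complex_ring E" "closedin (hilbert_topology E) W0"
    and inv0: "\<And>h w. \<lbrakk>h \<in> H; w \<in> W0\<rbrakk> \<Longrightarrow> rep_act \<rho> h w \<in> W0"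
    by auto
  have W0E: "W0 \<subseteq> carrier E"
    using E.submoduleE(1)[OF W0(1)] .
  have zero0: "\<zero>\<^bsub>E\<^esub> \<in> W0"
    using W0(1) subgroup.one_closed[of W0 "add_monoid E"] by (auto simp: submodule_def)
  define W where "W = {f \<in> carrier I. \<forall>x\<in>carrier G. f x \<in> W0}"
  have sub: "submodule W complex_ring I"
  proof (rule I.submoduleI)
    show "\<ominus>\<^bsub>I\<^esub> a \<in> W" if "a \<in> W" for a
      using that E.submoduleE(4)[OF W0(1), of "- 1"]
      by (auto simp: W_def I.smult_uminus_1[symmetric] induced_ops)
    show "a \<oplus>\<^bsub>I\<^esub> b \<in> W" if "a \<in> W" "b \<in> W" for a b
      using that E.submoduleE(5)[OF W0(1)] by (auto simp: W_def induced_ops)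
    show "c \<odot>\<^bsub>I\<^esub> a \<in> W" if "a \<in> W" for c a
      using that E.submoduleE(4)[OF W0(1), of c] by (auto simp: W_def induced_ops)
  qed (use zero0 in \<open>auto simp: W_def induced_ops\<close>)
  have closed: "closedin (hilbert_topology I) W"
    unfolding I.closedin_iff_approximable
  proof (intro conjI ballI impI)
    show "W \<subseteq> carrier I"
      by (auto simp: W_def)
    fix f assume f: "f \<in> carrier I" and ap: "\<forall>e>0. \<exists>w\<in>W. (hnorm I (f \<ominus>\<^bsub>I\<^esub> w))\<^sup>2 < e"
    have "f x \<in> W0" if x: "x \<in> carrier G" for x
    proof -
      have "\<exists>w\<in>W0. (hnorm E (f x \<ominus>\<^bsub>E\<^esub> w))\<^sup>2 < e" if e: "e > 0" for e
      proof -
        obtain w where w: "w \<in> W" "(hnorm I (f \<ominus>\<^bsub>I\<^esub> w))\<^sup>2 < e"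
          using ap e by blast
        then have wI: "w \<in> carrier I" and w0: "w x \<in> W0"
          using x by (auto simp: W_def)
        have "(hnorm E (f x \<ominus>\<^bsub>E\<^esub> w x))\<^sup>2 < e"
          using order.strict_trans1[OF hnorm_val_le[of "f \<ominus>\<^bsub>I\<^esub> w" x] w(2)] f wI x by (simp add: induced_minus)
        then show ?thesis
          using w0 by blast
      qed
      then show ?thesis
        using W0(2) f x unfolding E.closedin_iff_approximable by auto
    qed
    then show "f \<in> W"
      using f by (simp add: W_def)
  qed
  have "tr g ` W \<subseteq> W" if g: "g \<in> carrier G" for g
    using g by (auto simp: W_def tr_apply)
  then have cases: "W = {\<zero>\<^bsub>I\<^esub>} \<or> W = carrier I"
    using irrI[OF sub closed] by blast
  show "W0 = {\<zero>\<^bsub>E\<^esub>} \<or> W0 = carrier E"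
    using cases
  proof
    assume W: "W = {\<zero>\<^bsub>I\<^esub>}"
    have "v = \<zero>\<^bsub>E\<^esub>" if v: "v \<in> W0" for v
    proof -
      have "single v x \<in> W0" if "x \<in> carrier G" for x
        using v inv0 zero0 that by (simp add: single_def)
      then have "single v \<in> W"
        using v W0E by (auto simp: W_def)
      then have "single v \<one> = \<zero>\<^bsub>I\<^esub> \<one>"
        using W by simp
      then show ?thesis
        using v W0E by (auto simp: induced_ops)
    qed
    then show ?thesis
      using zero0 by blast
  next
    assume W: "W = carrier I"
    have "v \<in> W0" if v: "v \<in> carrier E" for v
    proof -
      have "single v \<in> W"
        using v W by simp
      then have "single v \<one> \<in> W0"
        by (simp add: W_def)
      then show ?thesis
        using v by simp
    qed
    then show ?thesis
      using W0E by blast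
  qed
qed

text \<open>A nonzero closed invariant subspace \<open>W\<close> contains, after a translation, a function with nonzero
  value at \<open>\<one>\<close>, and therefore a nonzero element of the copy of \<open>\<rho>\<close>. By irreducibility \<open>W\<close> contains this
  whole copy, and hence everything.\<close>

lemma irreducible_imp_irreducible_Ind:
  assumes irr: "irreducible_rep (G\<lparr>carrier := H\<rparr>) \<rho>"
    and V: "subgroup V G" "V \<subseteq> H" "\<And>v w. \<lbrakk>v \<in> V; w \<in> carrier E\<rbrakk> \<Longrightarrow> rep_act \<rho> v w = w"
    and orbits: "\<And>g. \<lbrakk>g \<in> carrier G; g \<notin> H\<rbrakk> \<Longrightarrow> infinite (coset_orbit V g H)"
  shows "irreducible_rep G (Ind G H \<rho>)"
proof -
  have space: "rep_space (Ind G H \<rho>) = I"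
    by (simp add: Ind_def)
  have nz: "carrier E \<noteq> {\<zero>\<^bsub>E\<^esub>}"
    and irrE: "\<And>W. \<lbrakk>submodule W complex_ring E; closedin (hilbert_topology E) W;
      \<And>h. h \<in> H \<Longrightarrow> rep_act \<rho> h ` W \<subseteq> W\<rbrakk> \<Longrightarrow> W = {\<zero>\<^bsub>E\<^esub>} \<or> W = carrier E"
    using irr unfolding irreducible_rep_def by auto
  have "carrier I \<noteq> {\<zero>\<^bsub>I\<^esub>}"
  proof
    assume I0: "carrier I = {\<zero>\<^bsub>I\<^esub>}"
    have "v = \<zero>\<^bsub>E\<^esub>" if v: "v \<in> carrier E" for v
    proof -
      have "single v = \<zero>\<^bsub>I\<^esub>"
        using single_closed[OF v] I0 by blast
      then have "single v \<one> = \<zero>\<^bsub>I\<^esub> \<one>"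
        by simp
      then show ?thesis
        using v by (simp add: induced_ops)
    qed
    then show False
      using nz E.M.zero_closed by blast
  qed
  moreover have "W = {\<zero>\<^bsub>I\<^esub>} \<or> W = carrier I"
    if W: "submodule W complex_ring I" "closedin (hilbert_topology I) W"
      and inv: "\<And>g f. \<lbrakk>g \<in> carrier G; f \<in> W\<rbrakk> \<Longrightarrow> tr g f \<in> W" for W
  proof (cases "W = {\<zero>\<^bsub>I\<^esub>}")
    case False
    have WI: "W \<subseteq> carrier I"
      using I.submoduleE(1)[OF W(1)] .
    have zW: "\<zero>\<^bsub>I\<^esub> \<in> W"
      using W(1) subgroup.one_closed[of W "add_monoid I"] by (auto simp: submodule_def)
    define W0 where "W0 = {v \<in> carrier E. single v \<in> W}"
    have sub0: "submodule W0 complex_ring E"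
    proof (rule E.submoduleI)
      have "single \<zero>\<^bsub>E\<^esub> = 0 \<odot>\<^bsub>I\<^esub> single \<zero>\<^bsub>E\<^esub>"
        using single_smult[of "\<zero>\<^bsub>E\<^esub>" 0] E.smult_r_null[of 0] by simp
      also have "\<dots> = \<zero>\<^bsub>I\<^esub>"
        using I.smult_l_null[of "single \<zero>\<^bsub>E\<^esub>"] by simp
      finally show "\<zero>\<^bsub>E\<^esub> \<in> W0"
        using zW by (simp add: W0_def)
      show "\<ominus>\<^bsub>E\<^esub> a \<in> W0" if "a \<in> W0" for a
        using that I.submoduleE(4)[OF W(1), of "- 1"]
        by (auto simp: W0_def E.smult_uminus_1[symmetric] single_smult)
      show "a \<oplus>\<^bsub>E\<^esub> b \<in> W0" if "a \<in> W0" "b \<in> W0" for a b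
        using that I.submoduleE(5)[OF W(1)] by (auto simp: W0_def single_add)
      show "c \<odot>\<^bsub>E\<^esub> a \<in> W0" if "a \<in> W0" for c a
        using that I.submoduleE(4)[OF W(1), of c] by (auto simp: W0_def single_smult)
    qed (auto simp: W0_def)
    have closed0: "closedin (hilbert_topology E) W0"
      unfolding E.closedin_iff_approximable
    proof (intro conjI ballI impI)
      show "W0 \<subseteq> carrier E"
        by (auto simp: W0_def)
      fix v assume v: "v \<in> carrier E" and ap: "\<forall>e>0. \<exists>w\<in>W0. (hnorm E (v \<ominus>\<^bsub>E\<^esub> w))\<^sup>2 < e"
      have "\<exists>f\<in>W. (hnorm I (single v \<ominus>\<^bsub>I\<^esub> f))\<^sup>2 < e" if e: "e > 0" for e
      proof -
        obtain w where w: "w \<in> carrier E" "single w \<in> W" "(hnorm E (v \<ominus>\<^bsub>E\<^esub> w))\<^sup>2 < e"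
          using ap e by (auto simp: W0_def)
        then have "(hnorm I (single v \<ominus>\<^bsub>I\<^esub> single w))\<^sup>2 < e"
          using v hnorm_single[of "v \<ominus>\<^bsub>E\<^esub> w"] by (simp add: single_minus)
        then show ?thesis
          using w(2) by blast
      qed
      then have "single v \<in> W"
        using W(2) v unfolding I.closedin_iff_approximable by auto
      then show "v \<in> W0"
        using v by (simp add: W0_def)
    qed
    have inv0: "rep_act \<rho> h ` W0 \<subseteq> W0" if h: "h \<in> H" for h
      using h inv[of h] by (auto simp: W0_def tr_single[symmetric])
    obtain f where f: "f \<in> W" "f \<noteq> \<zero>\<^bsub>I\<^esub>"
      using False zW by blast
    have fI: "f \<in> carrier I"
      using f(1) WI by auto
    obtain x where x: "x \<in> carrier G" "f x \<noteq> \<zero>\<^bsub>E\<^esub>"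
      using f(2) induced_eqI[OF fI zero_induced] by (auto simp: induced_ops)
    have "tr (inv x) f \<one> = f x"
      using x by (simp add: tr_apply)
    then have "single (f x) \<in> W"
      using single_in_closed_invariant[OF W inv V orbits inv[OF inv_closed[OF x(1)] f(1)]] by simp
    then have "f x \<in> W0"
      using fI x by (simp add: W0_def)
    then have "W0 = carrier E"
      using irrE[OF sub0 closed0 inv0] x(2) by blast
    then have "W = carrier I"
      by (intro closed_invariant_eq_carrier[OF W inv]) (auto simp: W0_def)
    then show ?thesis ..
  qed simp
  ultimately show ?thesis
    unfolding irreducible_rep_def space by (simp add: image_subset_iff)
qed

end

section \<open>Equivalence of induced representations\<close>

lemma unitary_map_inv_into:
  assumes E: "complex_inner_space E" and U: "unitary_map E F U"
  shows "unitary_map F E (inv_into (carrier E) U)"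
proof -
  interpret E: complex_inner_space E by (rule E)
  have bij: "bij_betw U (carrier E) (carrier F)"
    and add: "\<And>v w. \<lbrakk>v \<in> carrier E; w \<in> carrier E\<rbrakk> \<Longrightarrow> U (v \<oplus>\<^bsub>E\<^esub> w) = U v \<oplus>\<^bsub>F\<^esub> U w"
    and smult: "\<And>c v. v \<in> carrier E \<Longrightarrow> U (c \<odot>\<^bsub>E\<^esub> v) = c \<odot>\<^bsub>F\<^esub> U v"
    and hin: "\<And>v w. \<lbrakk>v \<in> carrier E; w \<in> carrier E\<rbrakk> \<Longrightarrow> hinner F (U v) (U w) = hinner E v w"
    using U unfolding unitary_map_def by blast+
  define W where "W = inv_into (carrier E) U"
  have W: "bij_betw W (carrier F) (carrier E)"
    unfolding W_def by (rule bij_betw_inv_into[OF bij])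
  have WU: "W (U v) = v" if "v \<in> carrier E" for v
    unfolding W_def by (rule bij_betw_inv_into_left[OF bij that])
  have ex: "\<exists>v\<in>carrier E. x = U v" if "x \<in> carrier F" for x
    using that bij unfolding bij_betw_def by blast
  have "unitary_map F E W"
    unfolding unitary_map_def
  proof (intro conjI ballI allI W)
    fix x y assume "x \<in> carrier F" "y \<in> carrier F"
    then obtain v w where v: "v \<in> carrier E" "x = U v" and w: "w \<in> carrier E" "y = U w"
      using ex by blast
    show "W (x \<oplus>\<^bsub>F\<^esub> y) = W x \<oplus>\<^bsub>E\<^esub> W y"
      using v w by (simp add: add[symmetric] WU)
    show "hinner E (W x) (W y) = hinner F x y"
      using v w by (simp add: hin WU)
  next
    fix c x assume "x \<in> carrier F"
    then obtain v where v: "v \<in> carrier E" "x = U v"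
      using ex by blast
    then show "W (c \<odot>\<^bsub>F\<^esub> x) = c \<odot>\<^bsub>E\<^esub> W x"
      by (simp add: smult[symmetric] WU)
  qed
  then show ?thesis
    by (simp add: W_def)
qed

text \<open>Stated for a single operator \<open>p\<close> and its image \<open>q\<close>, so that it applies both to translations and to
  actions that are twisted by a conjugation.\<close>

lemma inv_into_intertwines:
  assumes U: "bij_betw U C D" and p: "\<And>v. v \<in> C \<Longrightarrow> p v \<in> C"
    and inter: "\<And>v. v \<in> C \<Longrightarrow> U (p v) = q (U v)" and x: "x \<in> D"
  shows "inv_into C U (q x) = p (inv_into C U x)"
proof -
  obtain v where v: "v \<in> C" "x = U v"
    using x U unfolding bij_betw_def by blast
  then show ?thesis
    using p[OF v(1)] by (simp add: inter[symmetric] bij_betw_inv_into_left[OF U])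
qed

lemma rep_equivalent_sym:
  assumes \<pi>: "complex_inner_space (rep_space \<pi>)"
    and act: "\<And>g v. \<lbrakk>g \<in> carrier G; v \<in> carrier (rep_space \<pi>)\<rbrakk> \<Longrightarrow> rep_act \<pi> g v \<in> carrier (rep_space \<pi>)"
    and eq: "rep_equivalent G \<pi> \<rho>"
  shows "rep_equivalent G \<rho> \<pi>"
proof -
  obtain U where U: "unitary_map (rep_space \<pi>) (rep_space \<rho>) U"
    and inter: "\<And>g v. \<lbrakk>g \<in> carrier G; v \<in> carrier (rep_space \<pi>)\<rbrakk> \<Longrightarrow> U (rep_act \<pi> g v) = rep_act \<rho> g (U v)"
    using eq unfolding rep_equivalent_def by blast
  have "bij_betw U (carrier (rep_space \<pi>)) (carrier (rep_space \<rho>))"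
    using U by (simp add: unitary_map_def)
  then have "inv_into (carrier (rep_space \<pi>)) U (rep_act \<rho> g x)
      = rep_act \<pi> g (inv_into (carrier (rep_space \<pi>)) U x)"
    if "g \<in> carrier G" "x \<in> carrier (rep_space \<rho>)" for g x
    by (rule inv_into_intertwines) (use act inter that in auto)
  then show ?thesis
    using unitary_map_inv_into[OF \<pi> U] unfolding rep_equivalent_def by blast
qed

locale two_subgroup_reps =
  A: subgroup_rep G A \<rho> + B: subgroup_rep G B \<tau>
  for G :: "('g, 'm) monoid_scheme" (structure) and A B
    and \<rho> :: "('g, 'h) rep" and \<tau> :: "('g, 'k) rep"

lemma (in two_subgroup_reps) swap: "two_subgroup_reps G B A \<tau> \<rho>"
  by (intro two_subgroup_reps.intro A.subgroup_rep_axioms B.subgroup_rep_axioms)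

context two_subgroup_reps
begin

text \<open>If \<open>A = g B g\<inverse>\<close>, right translation by \<open>g\<inverse>\<close> turns \<open>A\<close>-equivariance into \<open>B\<close>-equivariance up to
  conjugation by \<open>g\<close>, which the intertwiner \<open>U\<close> between \<open>\<rho>\<close> and the conjugate of \<open>\<tau>\<close> absorbs.\<close>

definition right_translate :: "'g \<Rightarrow> ('h \<Rightarrow> 'k) \<Rightarrow> ('g \<Rightarrow> 'h) \<Rightarrow> 'g \<Rightarrow> 'k" where
  "right_translate g U f = (\<lambda>x\<in>carrier G. U (f (x \<otimes> inv g)))"

lemma right_translate_apply: "x \<in> carrier G \<Longrightarrow> right_translate g U f x = U (f (x \<otimes> inv g))"
  by (simp add: right_translate_def)

lemma
  assumes g: "g \<in> carrier G" and AB: "\<And>x. x \<in> carrier G \<Longrightarrow> g \<otimes> x \<otimes> inv g \<in> A \<longleftrightarrow> x \<in> B"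
    and U: "unitary_map A.E B.E U"
    and inter: "\<And>x v. \<lbrakk>x \<in> B; v \<in> carrier A.E\<rbrakk>
      \<Longrightarrow> U (rep_act \<rho> (g \<otimes> x \<otimes> inv g) v) = rep_act \<tau> x (U v)"
    and f: "f \<in> carrier A.I"
  shows right_translate_closed: "right_translate g U f \<in> carrier B.I"
    and right_translate_hinner: "f' \<in> carrier A.I \<Longrightarrow>
      hinner B.I (right_translate g U f) (right_translate g U f') = hinner A.I f f'"
proof -
  have UE: "U v \<in> carrier B.E" if "v \<in> carrier A.E" for v
    using U that unfolding unitary_map_def by (blast dest: bij_betwE)
  have hin: "hinner B.E (U v) (U w) = hinner A.E v w" if "v \<in> carrier A.E" "w \<in> carrier A.E" for v w
    using U that unfolding unitary_map_def by blast
  have hn: "hnorm B.E (U v) = hnorm A.E v" if "v \<in> carrier A.E" for v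
    using that by (simp add: hnorm_def hin)
  let ?Q = "(\<lambda>x. x \<otimes> inv g) ` B.R"
  have inj: "inj_on (\<lambda>x. x \<otimes> inv g) B.R"
    using g by (auto intro!: inj_onI)
  have Q: "left_transversal G A ?Q"
    unfolding A.left_transversal_iff[OF A.H_subgroup]
  proof (intro conjI ballI impI)
    show "?Q \<subseteq> carrier G"
      using g by auto
    show "\<exists>t\<in>?Q. \<exists>a\<in>A. x = t \<otimes> a" if x: "x \<in> carrier G" for x
    proof -
      obtain t b where tb: "t \<in> B.R" "b \<in> B" "x \<otimes> g = t \<otimes> b"
        using B.R_cases[of "x \<otimes> g"] g x by auto
      have "x = x \<otimes> g \<otimes> inv g"
        using g x by (simp add: A.m_assoc)
      also have "\<dots> = t \<otimes> inv g \<otimes> (g \<otimes> b \<otimes> inv g)"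
        using g tb by (simp add: A.m_assoc A.cancel_inv_left)
      finally show ?thesis
        using AB[of b] tb by auto
    qed
    fix s t assume st: "s \<in> ?Q" "t \<in> ?Q" "inv s \<otimes> t \<in> A"
    obtain s' t' where st': "s = s' \<otimes> inv g" "t = t' \<otimes> inv g" "s' \<in> B.R" "t' \<in> B.R"
      using st(1,2) by blast
    have "g \<otimes> (inv s' \<otimes> t') \<otimes> inv g \<in> A"
      using st(3) st' g by (simp add: A.inv_mult_group A.m_assoc)
    then have "inv s' \<otimes> t' \<in> B"
      using AB[of "inv s' \<otimes> t'"] st' by simp
    then show "s = t"
      using st' B.R_unique by blast
  qed
  have mult: "f (x \<otimes> b \<otimes> inv g) = rep_act \<rho> (g \<otimes> inv b \<otimes> inv g) (f (x \<otimes> inv g))"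
    if f: "f \<in> carrier A.I" and x: "x \<in> carrier G" and b: "b \<in> B" for f x b
  proof -
    have "x \<otimes> b \<otimes> inv g = x \<otimes> inv g \<otimes> (g \<otimes> b \<otimes> inv g)"
      using x b g by (simp add: A.m_assoc A.cancel_inv_left)
    then have "f (x \<otimes> b \<otimes> inv g) = rep_act \<rho> (inv (g \<otimes> b \<otimes> inv g)) (f (x \<otimes> inv g))"
      using A.induced_mult[OF f, of "x \<otimes> inv g" "g \<otimes> b \<otimes> inv g"] AB[of b] x b g by simp
    moreover have "inv (g \<otimes> b \<otimes> inv g) = g \<otimes> inv b \<otimes> inv g"
      using g b by (simp add: A.inv_mult_group A.m_assoc)
    ultimately show ?thesis
      by simp
  qed
  have "(\<lambda>x. (hnorm A.E (f x))\<^sup>2) summable_on ?Q"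
    using A.summable_on_left_transversal_cong[OF A.H_subgroup A.left_transversal_R Q,
        of "\<lambda>x. (hnorm A.E (f x))\<^sup>2"] f
    by (simp add: A.induced_hnorm_mult A.induced_summable)
  then have "((\<lambda>x. (hnorm A.E (f x))\<^sup>2) \<circ> (\<lambda>x. x \<otimes> inv g)) summable_on B.R"
    by (simp only: summable_on_reindex[OF inj])
  moreover have "(\<lambda>x. (hnorm B.E (right_translate g U f x))\<^sup>2) summable_on B.R
      \<longleftrightarrow> ((\<lambda>x. (hnorm A.E (f x))\<^sup>2) \<circ> (\<lambda>x. x \<otimes> inv g)) summable_on B.R"
    by (rule summable_on_cong) (use f g in \<open>simp add: right_translate_apply hn\<close>)
  moreover have "right_translate g U f (x \<otimes> b) = rep_act \<tau> (inv b) (right_translate g U f x)"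
    if x: "x \<in> carrier G" and b: "b \<in> B" for x b
    using mult[OF f x b] inter[of "inv b" "f (x \<otimes> inv g)"] f x b g by (simp add: right_translate_apply)
  ultimately show "right_translate g U f \<in> carrier B.I"
    using f g UE by (simp add: B.induced_carrier_iff right_translate_apply) (simp add: right_translate_def)
  show "hinner B.I (right_translate g U f) (right_translate g U f') = hinner A.I f f'"
    if f': "f' \<in> carrier A.I"
  proof -
    let ?F = "\<lambda>x. hinner A.E (f x) (f' x)"
    have "hinner B.I (right_translate g U f) (right_translate g U f') = infsum (?F \<circ> (\<lambda>x. x \<otimes> inv g)) B.R"
      unfolding B.hinner_induced
      by (rule infsum_cong) (use f f' g in \<open>simp add: right_translate_apply hin\<close>)
    also have "\<dots> = infsum ?F ?Q"
      by (rule infsum_reindex[OF inj, symmetric])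
    also have "\<dots> = infsum ?F A.R"
      using A.infsum_left_transversal_cong[OF A.H_subgroup A.left_transversal_R Q, of ?F] f f'
      by (simp add: A.induced_mult A.act_hinner)
    finally show ?thesis
      by (simp add: A.hinner_induced)
  qed
qed

lemma equivalent_conjugate_imp_equivalent_Ind:
  assumes g: "g \<in> carrier G" and AB: "A = g <# B #> inv g"
    and eq: "rep_equivalent (G\<lparr>carrier := A\<rparr>) \<rho> (conj_rep G g \<tau>)"
  shows "rep_equivalent G (Ind G A \<rho>) (Ind G B \<tau>)"
proof -
  obtain U where U: "unitary_map A.E B.E U"
    and inter: "\<And>a v. \<lbrakk>a \<in> A; v \<in> carrier A.E\<rbrakk> \<Longrightarrow> U (rep_act \<rho> a v) = rep_act \<tau> (inv g \<otimes> a \<otimes> g) (U v)"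
    using eq unfolding rep_equivalent_def conj_rep_def by auto
  have conjA: "a \<in> A \<longleftrightarrow> inv g \<otimes> a \<otimes> g \<in> B" if "a \<in> carrier G" for a
    using A.mem_conjugate_iff[OF B.H_subgroup g that] AB by simp
  have conjB: "g \<otimes> x \<otimes> inv g \<in> A \<longleftrightarrow> x \<in> B" if "x \<in> carrier G" for x
    using conjA[of "g \<otimes> x \<otimes> inv g"] g that by (simp add: A.m_assoc A.cancel_inv_left)
  have bij: "bij_betw U (carrier A.E) (carrier B.E)"
    and add: "\<And>v w. \<lbrakk>v \<in> carrier A.E; w \<in> carrier A.E\<rbrakk> \<Longrightarrow> U (v \<oplus>\<^bsub>A.E\<^esub> w) = U v \<oplus>\<^bsub>B.E\<^esub> U w"
    and smult: "\<And>c v. v \<in> carrier A.E \<Longrightarrow> U (c \<odot>\<^bsub>A.E\<^esub> v) = c \<odot>\<^bsub>B.E\<^esub> U v"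
    and hin: "\<And>v w. \<lbrakk>v \<in> carrier A.E; w \<in> carrier A.E\<rbrakk> \<Longrightarrow> hinner B.E (U v) (U w) = hinner A.E v w"
    using U unfolding unitary_map_def by blast+
  have interB: "U (rep_act \<rho> (g \<otimes> x \<otimes> inv g) v) = rep_act \<tau> x (U v)" if "x \<in> B" "v \<in> carrier A.E" for x v
    using inter[of "g \<otimes> x \<otimes> inv g" v] conjB[of x] g that by (simp add: A.m_assoc A.cancel_inv_left)
  define W where "W = inv_into (carrier A.E) U"
  have W: "unitary_map B.E A.E W"
    unfolding W_def by (rule unitary_map_inv_into[OF A.E.complex_inner_space_axioms U])
  have WU: "W (U v) = v" if "v \<in> carrier A.E" for v
    unfolding W_def by (rule bij_betw_inv_into_left[OF bij that])
  have UW: "U (W w) = w" if "w \<in> carrier B.E" for w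
    unfolding W_def by (rule bij_betw_inv_into_right[OF bij that])
  have interW: "W (rep_act \<tau> (inv g \<otimes> a \<otimes> inv (inv g)) w) = rep_act \<rho> a (W w)"
    if "a \<in> A" "w \<in> carrier B.E" for a w
    unfolding W_def
    by (rule inv_into_intertwines[OF bij, where p = "rep_act \<rho> a"]) (use inter that g in auto)
  interpret S: two_subgroup_reps G B A \<tau> \<rho>
    by (rule swap)
  let ?\<Theta> = "right_translate g U" and ?\<Theta>' = "S.right_translate (inv g) W"
  have closed: "?\<Theta> f \<in> carrier B.I" if "f \<in> carrier A.I" for f
    by (rule right_translate_closed[OF g conjB U interB that])
  have conjA': "inv g \<otimes> a \<otimes> inv (inv g) \<in> B \<longleftrightarrow> a \<in> A" if "a \<in> carrier G" for a
    using conjA[OF that] g by simp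
  have closed': "?\<Theta>' f \<in> carrier A.I" if "f \<in> carrier B.I" for f
    by (rule S.right_translate_closed[OF A.inv_closed[OF g] conjA' W interW that])
  have "?\<Theta>' (?\<Theta> f) = f" if f: "f \<in> carrier A.I" for f
    by (rule A.induced_eqI)
      (use f g closed[OF f] closed' in \<open>auto simp: right_translate_apply S.right_translate_apply A.m_assoc WU\<close>)
  moreover have "?\<Theta> (?\<Theta>' f) = f" if f: "f \<in> carrier B.I" for f
    by (rule B.induced_eqI)
      (use f g closed'[OF f] closed in \<open>auto simp: right_translate_apply S.right_translate_apply A.m_assoc UW\<close>)
  ultimately have bij\<Theta>: "bij_betw ?\<Theta> (carrier A.I) (carrier B.I)"
    using closed closed' by (intro bij_betw_byWitness[where f' = ?\<Theta>']) auto
  have "unitary_map A.I B.I ?\<Theta>"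
    unfolding unitary_map_def
  proof (intro conjI ballI allI bij\<Theta>)
    fix f f' assume f: "f \<in> carrier A.I" and f': "f' \<in> carrier A.I"
    show "?\<Theta> (f \<oplus>\<^bsub>A.I\<^esub> f') = ?\<Theta> f \<oplus>\<^bsub>B.I\<^esub> ?\<Theta> f'"
      by (rule B.induced_eqI)
        (use f f' g closed in \<open>auto simp: right_translate_apply A.induced_ops B.induced_ops add\<close>)
    show "hinner B.I (?\<Theta> f) (?\<Theta> f') = hinner A.I f f'"
      by (rule right_translate_hinner[OF g conjB U interB f f'])
  next
    fix c f assume f: "f \<in> carrier A.I"
    show "?\<Theta> (c \<odot>\<^bsub>A.I\<^esub> f) = c \<odot>\<^bsub>B.I\<^esub> ?\<Theta> f"
      by (rule B.induced_eqI)
        (use f g closed in \<open>auto simp: right_translate_apply A.induced_ops B.induced_ops smult\<close>)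
  qed
  moreover have "?\<Theta> (A.tr k f) = B.tr k (?\<Theta> f)" if "k \<in> carrier G" "f \<in> carrier A.I" for k f
    by (rule B.induced_eqI)
      (use that g closed in \<open>auto simp: right_translate_apply A.tr_apply B.tr_apply A.m_assoc\<close>)
  ultimately show ?thesis
    unfolding rep_equivalent_def by (auto simp: Ind_def)
qed

text \<open>An intertwiner \<open>\<Phi>\<close> maps the \<open>V\<close>-fixed function \<open>single v\<close> to a \<open>V\<close>-fixed function, which can be
  nonzero only at those \<open>x\<close> for which \<open>x B\<close> has a finite \<open>A\<close>-orbit; likewise for the inverse
  \<open>\<Psi>\<close> of \<open>\<Phi>\<close>. Taking nonzero vectors on both sides yields \<open>g\<close> and \<open>k\<close> as in
  \<open>commensurators_conjugate\<close>, so \<open>A = g B g\<inverse>\<close>. The same lemma shows that \<open>g B\<close> is the only coset with a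
  finite \<open>A\<close>-orbit. So \<open>\<Phi>\<close> carries the functions supported on \<open>A\<close> to those supported on \<open>g B\<close>, and
  \<open>v \<mapsto> \<Phi>(single v)(g)\<close> is the required equivalence.\<close>

lemma equivalent_Ind_imp_equivalent_conjugate:
  assumes rp: "roelcke_precompact G T" and cA: "commensurator G T A" and cB: "commensurator G T B"
    and V: "subgroup V G" "V \<subseteq> A" "finite (A.coset_orbit A \<one> V)"
      "\<And>a v. \<lbrakk>a \<in> V; v \<in> carrier A.E\<rbrakk> \<Longrightarrow> rep_act \<rho> a v = v"
    and W: "subgroup W G" "W \<subseteq> B" "finite (A.coset_orbit B \<one> W)"
      "\<And>b w. \<lbrakk>b \<in> W; w \<in> carrier B.E\<rbrakk> \<Longrightarrow> rep_act \<tau> b w = w"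
    and nzA: "carrier A.E \<noteq> {\<zero>\<^bsub>A.E\<^esub>}" and nzB: "carrier B.E \<noteq> {\<zero>\<^bsub>B.E\<^esub>}"
    and eq: "rep_equivalent G (Ind G A \<rho>) (Ind G B \<tau>)"
  shows "\<exists>g\<in>carrier G. A = g <# B #> inv g \<and> rep_equivalent (G\<lparr>carrier := A\<rparr>) \<rho> (conj_rep G g \<tau>)"
proof -
  have "rep_space (Ind G A \<rho>) = A.I" "rep_space (Ind G B \<tau>) = B.I"
    by (simp_all add: Ind_def)
  then obtain \<Phi> where \<Phi>: "unitary_map A.I B.I \<Phi>"
    and inter: "\<And>g f. \<lbrakk>g \<in> carrier G; f \<in> carrier A.I\<rbrakk> \<Longrightarrow> \<Phi> (A.tr g f) = B.tr g (\<Phi> f)"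
    using eq unfolding rep_equivalent_def by auto
  have bij: "bij_betw \<Phi> (carrier A.I) (carrier B.I)"
    and add: "\<And>f f'. \<lbrakk>f \<in> carrier A.I; f' \<in> carrier A.I\<rbrakk> \<Longrightarrow> \<Phi> (f \<oplus>\<^bsub>A.I\<^esub> f') = \<Phi> f \<oplus>\<^bsub>B.I\<^esub> \<Phi> f'"
    and smult: "\<And>c f. f \<in> carrier A.I \<Longrightarrow> \<Phi> (c \<odot>\<^bsub>A.I\<^esub> f) = c \<odot>\<^bsub>B.I\<^esub> \<Phi> f"
    and hin: "\<And>f f'. \<lbrakk>f \<in> carrier A.I; f' \<in> carrier A.I\<rbrakk> \<Longrightarrow> hinner B.I (\<Phi> f) (\<Phi> f') = hinner A.I f f'"
    using \<Phi> unfolding unitary_map_def by blast+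
  define \<Psi> where "\<Psi> = inv_into (carrier A.I) \<Phi>"
  have \<Phi>I: "\<Phi> f \<in> carrier B.I" if "f \<in> carrier A.I" for f
    using bij that by (blast dest: bij_betwE)
  have \<Psi>I: "\<Psi> f \<in> carrier A.I" if "f \<in> carrier B.I" for f
    using bij_betw_inv_into[OF bij] that unfolding \<Psi>_def by (blast dest: bij_betwE)
  have \<Phi>\<Psi>: "\<Phi> (\<Psi> f) = f" if "f \<in> carrier B.I" for f
    unfolding \<Psi>_def by (rule bij_betw_inv_into_right[OF bij that])
  have inter': "\<Psi> (B.tr g f) = A.tr g (\<Psi> f)" if "g \<in> carrier G" "f \<in> carrier B.I" for g f
    unfolding \<Psi>_def by (rule inv_into_intertwines[OF bij]) (use inter that in auto)
  have nonzero: "f \<noteq> \<zero>\<^bsub>A.I\<^esub>" if "\<Phi> f \<noteq> \<zero>\<^bsub>B.I\<^esub>" "f \<in> carrier A.I" for f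
  proof
    assume "f = \<zero>\<^bsub>A.I\<^esub>"
    then have "hinner B.I (\<Phi> f) (\<Phi> f) = 0"
      using that(2) by (simp add: hin)
    then show False
      using B.I.hinner_definite[OF \<Phi>I[OF that(2)]] that(1) by simp
  qed
  have nonzero': "\<Phi> f \<noteq> \<zero>\<^bsub>B.I\<^esub>" if "f \<noteq> \<zero>\<^bsub>A.I\<^esub>" "f \<in> carrier A.I" for f
  proof
    assume "\<Phi> f = \<zero>\<^bsub>B.I\<^esub>"
    then have "hinner A.I f f = 0"
      using hin[OF that(2,2)] by simp
    then show False
      using A.I.hinner_definite[OF that(2)] that(1) by simp
  qed
  have orbA: "finite (A.coset_orbit A x B)"
    if "v \<in> carrier A.E" "x \<in> carrier G" "\<Phi> (A.single v) x \<noteq> \<zero>\<^bsub>B.E\<^esub>" for v x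
  proof -
    have "B.tr a (\<Phi> (A.single v)) = \<Phi> (A.single v)" if "a \<in> V" for a
      using inter[of a "A.single v"] A.single_fixed[of a v] V \<open>a \<in> V\<close> \<open>v \<in> carrier A.E\<close> by auto
    then have "finite (A.coset_orbit V x B)"
      using B.fixed_imp_finite_orbit[OF V(1) \<Phi>I[OF A.single_closed[OF that(1)]] _ that(2,3)] by blast
    then show ?thesis
      using A.finite_coset_orbit_trans[OF A.H_subgroup V(1) B.H_subgroup A.one_closed that(2) V(3)] that(2)
      by simp
  qed
  have orbB: "finite (A.coset_orbit B x A)"
    if "w \<in> carrier B.E" "x \<in> carrier G" "\<Psi> (B.single w) x \<noteq> \<zero>\<^bsub>A.E\<^esub>" for w x
  proof -
    have "A.tr b (\<Psi> (B.single w)) = \<Psi> (B.single w)" if "b \<in> W" for b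
      using inter'[of b "B.single w"] B.single_fixed[of b w] W \<open>b \<in> W\<close> \<open>w \<in> carrier B.E\<close> by auto
    then have "finite (A.coset_orbit W x A)"
      using A.fixed_imp_finite_orbit[OF W(1) \<Psi>I[OF B.single_closed[OF that(1)]] _ that(2,3)] by blast
    then show ?thesis
      using A.finite_coset_orbit_trans[OF B.H_subgroup W(1) A.H_subgroup A.one_closed that(2) W(3)] that(2)
      by simp
  qed
  obtain v0 where v0: "v0 \<in> carrier A.E" "v0 \<noteq> \<zero>\<^bsub>A.E\<^esub>"
    using nzA A.E.M.zero_closed by blast
  have "A.single v0 \<noteq> \<zero>\<^bsub>A.I\<^esub>"
    using v0 A.hnorm_single[OF v0(1)] by auto
  then have "\<Phi> (A.single v0) \<noteq> \<zero>\<^bsub>B.I\<^esub>"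
    using nonzero' v0 by simp
  then obtain g where g: "g \<in> carrier G" "\<Phi> (A.single v0) g \<noteq> \<zero>\<^bsub>B.E\<^esub>"
    using B.induced_eqI[OF \<Phi>I[OF A.single_closed[OF v0(1)]] B.zero_induced] by (auto simp: B.induced_ops)
  obtain w0 where w0: "w0 \<in> carrier B.E" "w0 \<noteq> \<zero>\<^bsub>B.E\<^esub>"
    using nzB B.E.M.zero_closed by blast
  have "B.single w0 \<noteq> \<zero>\<^bsub>B.I\<^esub>"
    using w0 B.hnorm_single[OF w0(1)] by auto
  then have "\<Psi> (B.single w0) \<noteq> \<zero>\<^bsub>A.I\<^esub>"
    using nonzero[of "\<Psi> (B.single w0)"] \<Phi>\<Psi> \<Psi>I w0 by simp
  then obtain k where k: "k \<in> carrier G" "\<Psi> (B.single w0) k \<noteq> \<zero>\<^bsub>A.E\<^esub>"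
    using A.induced_eqI[OF \<Psi>I[OF B.single_closed[OF w0(1)]] A.zero_induced] by (auto simp: A.induced_ops)
  note fg = orbA[OF v0(1) g] and fk = orbB[OF w0(1) k]
  have AB: "A = g <# B #> inv g"
    by (rule A.commensurators_conjugate(1)[OF rp cA cB g(1) fg k(1) fk])
  have conjA: "a \<in> A \<longleftrightarrow> inv g \<otimes> a \<otimes> g \<in> B" if "a \<in> carrier G" for a
    using A.mem_conjugate_iff[OF B.H_subgroup g(1) that] AB by simp
  have suppB: "\<Phi> (A.single v) x = \<zero>\<^bsub>B.E\<^esub>"
    if v: "v \<in> carrier A.E" and x: "x \<in> carrier G" "inv g \<otimes> x \<notin> B" for v x
  proof (rule ccontr)
    assume "\<Phi> (A.single v) x \<noteq> \<zero>\<^bsub>B.E\<^esub>"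
    note fx = orbA[OF v x(1) this]
    have "k \<otimes> x \<in> B" "k \<otimes> g \<in> B"
      using A.commensurators_conjugate(2)[OF rp cB cA k(1) fk] x(1) fx g(1) fg by blast+
    then have "inv (k \<otimes> g) \<otimes> (k \<otimes> x) \<in> B"
      by blast
    moreover have "inv (k \<otimes> g) \<otimes> (k \<otimes> x) = inv g \<otimes> x"
      using k g x by (simp add: A.inv_mult_group A.m_assoc A.cancel_inv_left)
    ultimately show False
      using x(2) by simp
  qed
  have suppA: "\<Psi> (B.single w) x = \<zero>\<^bsub>A.E\<^esub>"
    if w: "w \<in> carrier B.E" and x: "x \<in> carrier G" "g \<otimes> x \<notin> A" for w x
    using A.commensurators_conjugate(2)[OF rp cA cB g(1) fg x(1) orbB[OF w x(1)]] x(2) by blast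
  define U where "U v = \<Phi> (A.single v) g" for v
  have UE: "U v \<in> carrier B.E" if "v \<in> carrier A.E" for v
    using that g \<Phi>I by (simp add: U_def)
  have Uhin: "hinner B.E (U v) (U w) = hinner A.E v w" if "v \<in> carrier A.E" "w \<in> carrier A.E" for v w
  proof -
    have "hinner B.E (U v) (U w) = hinner B.I (\<Phi> (A.single v)) (\<Phi> (A.single w))"
      unfolding U_def by (rule B.hinner_single_coset[symmetric]) (use that \<Phi>I g suppB in auto)
    then show ?thesis
      using that by (simp add: hin A.hinner_single)
  qed
  have Uadd: "U (v \<oplus>\<^bsub>A.E\<^esub> w) = U v \<oplus>\<^bsub>B.E\<^esub> U w" if "v \<in> carrier A.E" "w \<in> carrier A.E" for v w
    using that g by (simp add: U_def A.single_add add B.induced_ops)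
  have Usmult: "U (c \<odot>\<^bsub>A.E\<^esub> v) = c \<odot>\<^bsub>B.E\<^esub> U v" if "v \<in> carrier A.E" for c v
    using that g by (simp add: U_def A.single_smult smult B.induced_ops)
  have "inj_on U (carrier A.E)"
  proof (rule inj_onI)
    fix v w assume v: "v \<in> carrier A.E" and w: "w \<in> carrier A.E" and eq: "U v = U w"
    have "U (v \<ominus>\<^bsub>A.E\<^esub> w) = U v \<ominus>\<^bsub>B.E\<^esub> U w"
      using v w UE by (simp add: A.E.minus_conv_smult B.E.minus_conv_smult Uadd Usmult)
    then have "U (v \<ominus>\<^bsub>A.E\<^esub> w) = \<zero>\<^bsub>B.E\<^esub>"
      using eq w UE B.E.minus_eq_zero_iff by simp
    then have "hinner A.E (v \<ominus>\<^bsub>A.E\<^esub> w) (v \<ominus>\<^bsub>A.E\<^esub> w) = 0"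
      using Uhin[of "v \<ominus>\<^bsub>A.E\<^esub> w" "v \<ominus>\<^bsub>A.E\<^esub> w"] v w by simp
    then show "v = w"
      using A.E.hinner_definite[of "v \<ominus>\<^bsub>A.E\<^esub> w"] A.E.minus_eq_zero_iff v w by simp
  qed
  moreover have "\<exists>v\<in>carrier A.E. w = U v" if w: "w \<in> carrier B.E" for w
  proof -
    \<comment> \<open>\<open>\<Psi>(single w)\<close> is supported on \<open>g\<inverse> A\<close>; translating by \<open>g\<close> moves it to the copy of \<open>\<rho>\<close>.\<close>
    define f where "f = A.tr g (\<Psi> (B.single w))"
    have f: "f \<in> carrier A.I"
      using g w \<Psi>I by (simp add: f_def)
    have "f = A.single (f \<one>)"
    proof (rule A.single_eqI[OF f])
      fix x assume x: "x \<in> carrier G" "x \<notin> A"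
      then show "f x = \<zero>\<^bsub>A.E\<^esub>"
        using suppA[OF w, of "inv g \<otimes> x"] g by (simp add: f_def A.tr_apply A.cancel_inv_left)
    qed
    moreover have "\<Phi> f = B.tr g (B.single w)"
      using w g \<Phi>\<Psi> \<Psi>I by (simp add: f_def inter)
    ultimately have "U (f \<one>) = B.tr g (B.single w) g"
      by (simp add: U_def)
    also have "\<dots> = w"
      using g w by (simp add: B.tr_apply)
    finally show ?thesis
      using f by auto
  qed
  ultimately have "bij_betw U (carrier A.E) (carrier B.E)"
    using UE unfolding bij_betw_def by blast
  then have "unitary_map A.E B.E U"
    unfolding unitary_map_def using Uadd Usmult Uhin by blast
  moreover have "U (rep_act \<rho> a v) = rep_act \<tau> (inv g \<otimes> a \<otimes> g) (U v)" if a: "a \<in> A" and v: "v \<in> carrier A.E" for a v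
  proof -
    have ac: "a \<in> carrier G" using a by simp
    have "U (rep_act \<rho> a v) = B.tr a (\<Phi> (A.single v)) g"
      using a v by (simp add: U_def A.tr_single[symmetric] inter)
    also have "\<dots> = \<Phi> (A.single v) (g \<otimes> (inv g \<otimes> inv a \<otimes> g))"
      using g ac by (simp add: B.tr_apply A.m_assoc A.cancel_inv_left)
    also have "\<dots> = rep_act \<tau> (inv (inv g \<otimes> inv a \<otimes> g)) (U v)"
      unfolding U_def using conjA[of "inv a"] a v g \<Phi>I by (intro B.induced_mult) auto
    also have "inv (inv g \<otimes> inv a \<otimes> g) = inv g \<otimes> a \<otimes> g"
      using g ac by (simp add: A.inv_mult_group A.m_assoc)
    finally show ?thesis .
  qed
  ultimately have "rep_equivalent (G\<lparr>carrier := A\<rparr>) \<rho> (conj_rep G g \<tau>)"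
    unfolding rep_equivalent_def conj_rep_def by auto
  then show ?thesis
    using g(1) AB by blast
qed

end

section \<open>Representations of quotient groups\<close>

text \<open>Restating the hypotheses on \<open>\<sigma>\<close> for the group \<open>H\<close> itself, on which \<open>V\<close> acts trivially. That
  the identity acts as the identity follows from multiplicativity and injectivity of the operators.\<close>

lemma (in group) subgroup_rep_inflate:
  assumes H: "subgroup H G" and V: "V \<lhd> G\<lparr>carrier := H\<rparr>"
    and \<sigma>: "unitary_rep (G\<lparr>carrier := H\<rparr> Mod V) T \<sigma>"
  shows "subgroup_rep G H (inflate (G\<lparr>carrier := H\<rparr>) V \<sigma>)"
    and "\<And>v w. \<lbrakk>v \<in> V; w \<in> carrier (rep_space \<sigma>)\<rbrakk>
      \<Longrightarrow> rep_act (inflate (G\<lparr>carrier := H\<rparr>) V \<sigma>) v w = w"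
    and "irreducible_rep (G\<lparr>carrier := H\<rparr>) (inflate (G\<lparr>carrier := H\<rparr>) V \<sigma>)
      \<longleftrightarrow> irreducible_rep (G\<lparr>carrier := H\<rparr> Mod V) \<sigma>"
proof -
  let ?H = "G\<lparr>carrier := H\<rparr>" and ?\<rho> = "inflate (G\<lparr>carrier := H\<rparr>) V \<sigma>"
  interpret V: normal V ?H by (rule V)
  interpret hil: complex_hilbert_space "rep_space \<sigma>"
    using \<sigma> by (simp add: unitary_rep_def)
  have coset: "V #>\<^bsub>?H\<^esub> h \<in> carrier (?H Mod V)" if "h \<in> H" for h
    using that V.subset by (auto simp: FactGroup_def RCOSETS_def)
  have mult: "V #>\<^bsub>?H\<^esub> (g \<otimes> h) = (V #>\<^bsub>?H\<^esub> g) \<otimes>\<^bsub>?H Mod V\<^esub> (V #>\<^bsub>?H\<^esub> h)" if "g \<in> H" "h \<in> H" for g h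
    using V.rcos_sum[of g h] that by (simp add: FactGroup_def)
  show rep: "subgroup_rep G H ?\<rho>"
  proof (intro subgroup_rep.intro subgroup_rep_axioms.intro group_axioms H)
    show "complex_inner_space (rep_space ?\<rho>)"
      using hil.complex_inner_space_axioms by (simp add: inflate_def)
    show "unitary_map (rep_space ?\<rho>) (rep_space ?\<rho>) (rep_act ?\<rho> h)" if "h \<in> H" for h
      using \<sigma> coset[OF that] by (simp add: unitary_rep_def inflate_def)
    show "rep_act ?\<rho> (g \<otimes> h) v = rep_act ?\<rho> g (rep_act ?\<rho> h v)"
      if g: "g \<in> H" and h: "h \<in> H" and v: "v \<in> carrier (rep_space ?\<rho>)" for g h v
    proof -
      have "v \<in> carrier (rep_space \<sigma>)"
        using v by (simp add: inflate_def)
      then have "rep_act \<sigma> (V #>\<^bsub>?H\<^esub> (g \<otimes> h)) v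
          = rep_act \<sigma> (V #>\<^bsub>?H\<^esub> g) (rep_act \<sigma> (V #>\<^bsub>?H\<^esub> h) v)"
        using \<sigma> coset[OF g] coset[OF h] unfolding unitary_rep_def mult[OF g h] by blast
      then show ?thesis
        by (simp add: inflate_def)
    qed
  qed
  show "rep_act ?\<rho> v w = w" if v: "v \<in> V" and w: "w \<in> carrier (rep_space \<sigma>)" for v w
  proof -
    interpret rep: subgroup_rep G H ?\<rho> by (rule rep)
    have "V #>\<^bsub>?H\<^esub> v = V #>\<^bsub>?H\<^esub> \<one>"
      using V.rcos_const[OF subgroup.subgroup_is_group[OF H group_axioms]] v
        subgroup.one_closed[OF V.subgroup_axioms] by simp
    then have "rep_act ?\<rho> v w = rep_act ?\<rho> \<one> w"
      by (simp add: inflate_def)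
    then show ?thesis
      using rep.act_one[of w] w by (simp add: inflate_def)
  qed
  have "carrier (?H Mod V) = (\<lambda>h. V #>\<^bsub>?H\<^esub> h) ` H"
    by (auto simp: FactGroup_def RCOSETS_def)
  then show "irreducible_rep ?H ?\<rho> \<longleftrightarrow> irreducible_rep (?H Mod V) \<sigma>"
    by (simp add: irreducible_rep_def inflate_def)
qed

context group
begin

lemma commensurator_normal_open:
  assumes rp: "roelcke_precompact G T" and H: "commensurator G T H"
    and V: "V \<lhd> G\<lparr>carrier := H\<rparr>" "openin (subtopology T H) V"
  shows "subgroup V G" "V \<subseteq> H" "finite (coset_orbit H \<one> V)"
proof -
  have sH: "subgroup H G" and oH: "openin T H"
    using H by (auto simp: commensurator_def)
  have "subgroup V (G\<lparr>carrier := H\<rparr>)"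
    using V(1) by (simp add: normal_def)
  then show "subgroup V G" "V \<subseteq> H"
    using incl_subgroup[OF sH] subgroup.subset[of V "G\<lparr>carrier := H\<rparr>"] by auto
  have "openin T V"
    using V(2) oH by (simp add: openin_open_subtopology)
  then show "finite (coset_orbit H \<one> V)"
    by (rule finite_coset_orbit_normal[OF rp sH V(1)])
qed

lemma irreducible_Ind_inflate_iff:
  assumes rp: "roelcke_precompact G T" and H: "commensurator G T H"
    and V: "V \<lhd> G\<lparr>carrier := H\<rparr>" "openin (subtopology T H) V"
    and \<sigma>: "unitary_rep (G\<lparr>carrier := H\<rparr> Mod V) S \<sigma>"
  shows "irreducible_rep G (Ind G H (inflate (G\<lparr>carrier := H\<rparr>) V \<sigma>))
    \<longleftrightarrow> irreducible_rep (G\<lparr>carrier := H\<rparr> Mod V) \<sigma>"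
proof -
  have sH: "subgroup H G"
    using H by (simp add: commensurator_def)
  note rep = subgroup_rep_inflate[OF sH V(1) \<sigma>] and VH = commensurator_normal_open[OF rp H V]
  interpret subgroup_rep G H "inflate (G\<lparr>carrier := H\<rparr>) V \<sigma>"
    by (rule rep(1))
  have "infinite (coset_orbit V g H)" if g: "g \<in> carrier G" "g \<notin> H" for g
  proof
    assume "finite (coset_orbit V g H)"
    then have "finite (coset_orbit H g H)"
      using finite_coset_orbit_trans[OF sH VH(1) sH one_closed g(1) VH(3)] g(1) by simp
    then show False
      using commensurator_finite_coset_orbit[OF rp H g(1)] g(2) by blast
  qed
  moreover have "rep_act (inflate (G\<lparr>carrier := H\<rparr>) V \<sigma>) v w = w" if "v \<in> V" "w \<in> carrier E" for v w
    using rep(2) that by (simp add: inflate_def)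
  ultimately show ?thesis
    using irreducible_Ind_imp_irreducible irreducible_imp_irreducible_Ind[OF _ VH(1,2)] rep(3) by blast
qed

lemma equivalent_Ind_inflate_iff:
  assumes rp: "roelcke_precompact G T" and A: "commensurator G T A" and B: "commensurator G T B"
    and V: "V \<lhd> G\<lparr>carrier := A\<rparr>" "openin (subtopology T A) V"
    and W: "W \<lhd> G\<lparr>carrier := B\<rparr>" "openin (subtopology T B) W"
    and \<sigma>: "unitary_rep (G\<lparr>carrier := A\<rparr> Mod V) S \<sigma>" "carrier (rep_space \<sigma>) \<noteq> {\<zero>\<^bsub>rep_space \<sigma>\<^esub>}"
    and \<tau>: "unitary_rep (G\<lparr>carrier := B\<rparr> Mod W) S' \<tau>" "carrier (rep_space \<tau>) \<noteq> {\<zero>\<^bsub>rep_space \<tau>\<^esub>}"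
  shows "rep_equivalent G (Ind G A (inflate (G\<lparr>carrier := A\<rparr>) V \<sigma>)) (Ind G B (inflate (G\<lparr>carrier := B\<rparr>) W \<tau>))
    \<longleftrightarrow> (\<exists>g\<in>carrier G. B = g <# A #> inv g \<and>
      rep_equivalent (G\<lparr>carrier := B\<rparr>) (inflate (G\<lparr>carrier := B\<rparr>) W \<tau>)
        (conj_rep G g (inflate (G\<lparr>carrier := A\<rparr>) V \<sigma>)))"
    (is "rep_equivalent G ?IA ?IB \<longleftrightarrow> ?conj")
proof -
  have sA: "subgroup A G" and sB: "subgroup B G"
    using A B by (simp_all add: commensurator_def)
  note repA = subgroup_rep_inflate[OF sA V(1) \<sigma>(1)] and VA = commensurator_normal_open[OF rp A V]
  note repB = subgroup_rep_inflate[OF sB W(1) \<tau>(1)] and WB = commensurator_normal_open[OF rp B W]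
  interpret BA: two_subgroup_reps G B A "inflate (G\<lparr>carrier := B\<rparr>) W \<tau>" "inflate (G\<lparr>carrier := A\<rparr>) V \<sigma>"
    by (intro two_subgroup_reps.intro repA(1) repB(1))
  have spaces: "rep_space ?IA = BA.B.I" "rep_space ?IB = BA.A.I"
    by (simp_all add: Ind_def)
  have sym1: "rep_equivalent G ?IB ?IA" if "rep_equivalent G ?IA ?IB"
    by (rule rep_equivalent_sym[OF _ _ that]) (auto simp: spaces intro: BA.B.I.complex_inner_space_axioms)
  have sym2: "rep_equivalent G ?IA ?IB" if "rep_equivalent G ?IB ?IA"
    by (rule rep_equivalent_sym[OF _ _ that]) (auto simp: spaces intro: BA.A.I.complex_inner_space_axioms)
  have trivB: "rep_act (inflate (G\<lparr>carrier := B\<rparr>) W \<tau>) b w = w" if "b \<in> W" "w \<in> carrier BA.A.E" for b w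
    using repB(2) that by (simp add: inflate_def)
  have trivA: "rep_act (inflate (G\<lparr>carrier := A\<rparr>) V \<sigma>) a v = v" if "a \<in> V" "v \<in> carrier BA.B.E" for a v
    using repA(2) that by (simp add: inflate_def)
  have nz: "carrier BA.A.E \<noteq> {\<zero>\<^bsub>BA.A.E\<^esub>}" "carrier BA.B.E \<noteq> {\<zero>\<^bsub>BA.B.E\<^esub>}"
    using \<sigma>(2) \<tau>(2) by (simp_all add: inflate_def)
  show ?thesis
  proof
    assume "rep_equivalent G ?IA ?IB"
    from sym1[OF this] show ?conj
      using BA.equivalent_Ind_imp_equivalent_conjugate[OF rp B A WB trivB VA trivA nz] by blast
  next
    assume ?conj
    then show "rep_equivalent G ?IA ?IB"
      using BA.equivalent_conjugate_imp_equivalent_Ind sym2 by blast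
  qed
qed

end

theorem proposition4p1:
  fixes \<Omega> :: "'a set" and K :: "('a \<Rightarrow> 'a) set"
    and G :: "('a \<Rightarrow> 'a) monoid" and T :: "('a \<Rightarrow> 'a) topology"
  assumes "countable \<Omega>" and "infinite \<Omega>"
    and "subgroup K (BijGroup \<Omega>)"
    and "G = (BijGroup \<Omega>)\<lparr>carrier := K\<rparr>"
    and "T = subtopology (pointwise_topology \<Omega>) K"
    and "roelcke_precompact G T"
  shows
    "(\<forall>H V (\<sigma> :: (('a \<Rightarrow> 'a) set, 'h) rep).
        commensurator G T H \<and>
        V \<lhd> G\<lparr>carrier := H\<rparr> \<and> openin (subtopology T H) V \<and>
        unitary_rep (G\<lparr>carrier := H\<rparr> Mod V)
          (quotient_topology (G\<lparr>carrier := H\<rparr>) (subtopology T H) V) \<sigma> \<longrightarrow>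
        (irreducible_rep G (Ind G H (inflate (G\<lparr>carrier := H\<rparr>) V \<sigma>)) \<longleftrightarrow>
         irreducible_rep (G\<lparr>carrier := H\<rparr> Mod V) \<sigma>)) \<and>
     (\<forall>H\<^sub>1 H\<^sub>2 V\<^sub>1 V\<^sub>2 (\<sigma>\<^sub>1 :: (('a \<Rightarrow> 'a) set, 'h1) rep) (\<sigma>\<^sub>2 :: (('a \<Rightarrow> 'a) set, 'h2) rep).
        commensurator G T H\<^sub>1 \<and> commensurator G T H\<^sub>2 \<and>
        V\<^sub>1 \<lhd> G\<lparr>carrier := H\<^sub>1\<rparr> \<and> openin (subtopology T H\<^sub>1) V\<^sub>1 \<and>
        V\<^sub>2 \<lhd> G\<lparr>carrier := H\<^sub>2\<rparr> \<and> openin (subtopology T H\<^sub>2) V\<^sub>2 \<and>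
        unitary_rep (G\<lparr>carrier := H\<^sub>1\<rparr> Mod V\<^sub>1)
          (quotient_topology (G\<lparr>carrier := H\<^sub>1\<rparr>) (subtopology T H\<^sub>1) V\<^sub>1) \<sigma>\<^sub>1 \<and>
        irreducible_rep (G\<lparr>carrier := H\<^sub>1\<rparr> Mod V\<^sub>1) \<sigma>\<^sub>1 \<and>
        unitary_rep (G\<lparr>carrier := H\<^sub>2\<rparr> Mod V\<^sub>2)
          (quotient_topology (G\<lparr>carrier := H\<^sub>2\<rparr>) (subtopology T H\<^sub>2) V\<^sub>2) \<sigma>\<^sub>2 \<and>
        irreducible_rep (G\<lparr>carrier := H\<^sub>2\<rparr> Mod V\<^sub>2) \<sigma>\<^sub>2 \<longrightarrow>
        (rep_equivalent G
           (Ind G H\<^sub>1 (inflate (G\<lparr>carrier := H\<^sub>1\<rparr>) V\<^sub>1 \<sigma>\<^sub>1))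
           (Ind G H\<^sub>2 (inflate (G\<lparr>carrier := H\<^sub>2\<rparr>) V\<^sub>2 \<sigma>\<^sub>2)) \<longleftrightarrow>
         (\<exists>g\<in>carrier G.
            H\<^sub>2 = g <#\<^bsub>G\<^esub> H\<^sub>1 #>\<^bsub>G\<^esub> inv\<^bsub>G\<^esub> g \<and>
            rep_equivalent (G\<lparr>carrier := H\<^sub>2\<rparr>)
              (inflate (G\<lparr>carrier := H\<^sub>2\<rparr>) V\<^sub>2 \<sigma>\<^sub>2)
              (conj_rep G g (inflate (G\<lparr>carrier := H\<^sub>1\<rparr>) V\<^sub>1 \<sigma>\<^sub>1)))))"
proof -
  interpret BG: group "BijGroup \<Omega>"
    by (rule group_BijGroup)
  interpret G: group G
    unfolding assms(4) by (rule subgroup.subgroup_is_group[OF assms(3) BG.group_axioms])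
  note rp = assms(6)
  show ?thesis
    by (intro conjI allI impI; elim conjE)
      (rule G.irreducible_Ind_inflate_iff[OF rp] G.equivalent_Ind_inflate_iff[OF rp];
        simp add: irreducible_rep_def)+
qed

end
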